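(* Let $k$ be an algebraically closed field of characteristic $0$, let $V=k^{m|n}$, and let $r\ge 0$ be an integer. For a commutative superalgebra $A$ over $k$, let $\rho_{r,A}:\mathbf{GL}(m|n)(A)\to \mathbf{End}(T^r(V))(A)$ be the diagonal tensor action and let $\theta_{r,A}:\mathbf{gl}(m|n)(A)\to \mathbf{End}(T^r(V))(A)$ be the action by derivations. Then for every commutative superalgebra $A$, $$ \langle \rho_{r,A}(\mathbf{GL}(m|n)(A))\rangle_A=\langle\theta_{r,A}(\mathbf{gl}(m|n)(A))\rangle_A , $$ where $\langle S\rangle_A$ denotes the subalgebra generated by the set $S$ inside $\mathbf{End}(T^r(V))(A)$.
   Context: All algebras are over $k$. A superalgebra is a $\mathbf{Z}/2$-graded algebra $A=A_0\oplus A_1$; $p(x)$ is the parity of a homogeneous element $x$. $A$ is commutative if $xy=(-1)^{p(x)p(y)}yx$ for homogeneous $x,y$. $V=k^{m|n}=V_0\oplus V_1$ is the super vector space with $V_0=k^m$ (even part) and $V_1=k^n$ (odd part). For a finite-dimensional super vector space $W$, $\mathrm{End}(W)=\mathrm{End}(W)_0\oplus\mathrm{End}(W)_1$ (parity-preserving and parity-reversing endomorphisms), and $\mathbf{End}(W)(A)=(A\otimes \mathrm{End}(W))_0=A_0\otimes\mathrm{End}(W)_0\oplus A_1\otimes\mathrm{End}(W)_1$, which acts on $A\otimes W$ by $(a\otimes X)(b\otimes w)=(-1)^{p(X)p(b)}ab\otimes X(w)$. $\mathbf{GL}(m|n)(A)$ is the group of automorphisms of the $A$-supermodule $A\otimes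 V$, i.e. the group of block matrices $\begin{pmatrix} a&\beta\\ \gamma& d\end{pmatrix}$ with $a$ ($m\times m$) and $d$ ($n\times n$) invertible with entries in $A_0$, and $\beta,\gamma$ with entries in $A_1$. $\mathfrak{gl}(m|n)=\mathrm{End}(k^{m|n})$ as a super vector space, and $\mathbf{gl}(m|n)(A)=\mathbf{End}(k^{m|n})(A)$. $T^r(V)=V^{\otimes r}$ is a super vector space with $p(v_1\otimes\cdots\otimes v_r)=p(v_1)+\cdots+p(v_r)$, and $A\otimes T^r(V)$ is identified with the $r$-fold tensor product of $A\otimes V$ over $A$. The action $\rho_r$ is $$\rho_{r,A}(g)(v_1\otimes\cdots\otimes v_r)=g(v_1)\otimes\cdots\otimes g(v_r),\qquad g\in\mathbf{GL}(m|n)(A),\ v_i\in A\otimes V.$$ The action $\theta_r$ of $\mathfrak{gl}(m|n)$ on $T^r(V)$ by derivations is, for homogeneous $X\in\mathfrak{gl}(m|n)$ and homogeneous $v_i\in V$, $$\theta_r(X)(v_1\otimes\cdots\otimes v_r)=\sum_{i=1}^r(-1)^{p(X)o(i)}\,v_1\otimes\cdots\otimes v_{i-1}\otimes X(v_i)\otimes v_{i+1}\otimes\cdots\otimes v_r,$$ where $o(i)$ is the number of odd elements among $v_1,\dots,v_{i-1}$; and $\theta_{r,A}$ is given by $\theta_{r,A}(a\otimes X)=a\otimes\theta_r(X)$, extended additively. *)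

theory Defs
  imports Complex_Main "HOL-Library.Z2" "HOL-Computational_Algebra.Polynomial"
begin

section \<open>Commutative superalgebras\<close>

text \<open>
  The parity group is the type \<^typ>\<open>bit\<close> (the integers modulo 2).  A superalgebra structure on the
  ring \<^typ>\<open>'a\<close> consists of a scalar multiplication by \<^typ>\<open>'k\<close> and of its homogeneous parts
  \<open>G 0\<close> and \<open>G 1\<close>.  The sort \<^class>\<open>ring\<close>, \<^class>\<open>monoid_mult\<close> is that of unital rings in which
  \<open>0 = 1\<close> is not excluded.
\<close>

definition ksign :: "bit \<Rightarrow> 'a::uminus \<Rightarrow> 'a"
  where "ksign p x = (if p = 1 then - x else x)"

locale comm_superalgebra = vector_space scale
  for scale :: "'k::field \<Rightarrow> 'a::{ring, monoid_mult} \<Rightarrow> 'a" +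
  fixes G :: "bit \<Rightarrow> 'a set"
  assumes scale_mult_left: "scale c x * y = scale c (x * y)"
    and scale_mult_right: "x * scale c y = scale c (x * y)"
    and subspace_part: "subspace (G p)"
    and direct_sum: "\<exists>!z. fst z \<in> G 0 \<and> snd z \<in> G 1 \<and> x = fst z + snd z"
    and one_even: "1 \<in> G 0"
    and mult_part: "x \<in> G p \<Longrightarrow> y \<in> G q \<Longrightarrow> x * y \<in> G (p + q)"
    and supercommute: "x \<in> G p \<Longrightarrow> y \<in> G q \<Longrightarrow> x * y = ksign (p * q) (y * x)"

definition hcomp :: "(bit \<Rightarrow> 'a::ab_group_add set) \<Rightarrow> bit \<Rightarrow> 'a \<Rightarrow> 'a"
  where "hcomp G p x = (THE y. y \<in> G p \<and> x - y \<in> G (p + 1))"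

text \<open>\<open>twist G p x\<close> is \<open>(-1)^(p * q) * x\<close> if \<open>x\<close> has parity \<open>q\<close>, extended additively: the effect of
  moving an object of parity \<open>p\<close> past the coefficient \<open>x\<close>.\<close>

definition twist :: "(bit \<Rightarrow> 'a::ab_group_add set) \<Rightarrow> bit \<Rightarrow> 'a \<Rightarrow> 'a"
  where "twist G p x = (if p = 1 then hcomp G 0 x - hcomp G 1 x else x)"


section \<open>Super vector spaces with a homogeneous basis\<close>

text \<open>
  A finite-dimensional super vector space \<open>W\<close> is given by a finite set \<open>I\<close> indexing a homogeneous
  basis and by the parities \<open>P i\<close> of the basis vectors.  An element of \<open>A \<otimes> W\<close> is the family of its
  coordinates, \<open>v\<close> standing for the sum of the \<open>v i \<otimes> e\<^sub>i\<close>.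
\<close>

definition unit_vec :: "'i \<Rightarrow> 'i \<Rightarrow> 'a::{zero, one}"
  where "unit_vec i = (\<lambda>j. if j = i then 1 else 0)"

definition ext_space :: "'i set \<Rightarrow> ('i \<Rightarrow> 'a::zero) set"
  where "ext_space I = {v. \<forall>i. i \<notin> I \<longrightarrow> v i = 0}"

definition ext_part :: "(bit \<Rightarrow> 'a::zero set) \<Rightarrow> 'i set \<Rightarrow> ('i \<Rightarrow> bit) \<Rightarrow> bit \<Rightarrow> ('i \<Rightarrow> 'a) set"
  where "ext_part G I P q = {v \<in> ext_space I. \<forall>i\<in>I. v i \<in> G (q + P i)}"

text \<open>
  An element of \<open>A \<otimes> End(W)\<close> is the matrix of its coordinates, \<open>T\<close> standing for the sum of the
  \<open>T i j \<otimes> E\<^sub>i\<^sub>j\<close>, where the elementary matrix \<open>E\<^sub>i\<^sub>j\<close> (sending \<open>e\<^sub>j\<close> to \<open>e\<^sub>i\<close>) has parity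
  \<open>P i + P j\<close>.  The product below is the one of the super tensor product,
  \<open>(a \<otimes> X)(b \<otimes> Y) = (-1)^(p(X) p(b)) (ab \<otimes> XY)\<close>; because the coefficients are written on the left,
  it differs by signs from the ordinary matrix product.
\<close>

definition EndA :: "(bit \<Rightarrow> 'a::zero set) \<Rightarrow> 'i set \<Rightarrow> ('i \<Rightarrow> bit) \<Rightarrow> ('i \<Rightarrow> 'i \<Rightarrow> 'a) set"
  where "EndA G I P =
    {T. (\<forall>i\<in>I. \<forall>j\<in>I. T i j \<in> G (P i + P j)) \<and> (\<forall>i j. i \<notin> I \<or> j \<notin> I \<longrightarrow> T i j = 0)}"

definition end_one :: "'i set \<Rightarrow> 'i \<Rightarrow> 'i \<Rightarrow> 'a::{zero, one}"
  where "end_one I = (\<lambda>i j. if i \<in> I \<and> i = j then 1 else 0)"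

definition end_mult ::
    "(bit \<Rightarrow> 'a::ring set) \<Rightarrow> 'i set \<Rightarrow> ('i \<Rightarrow> bit) \<Rightarrow> ('i \<Rightarrow> 'i \<Rightarrow> 'a) \<Rightarrow> ('i \<Rightarrow> 'i \<Rightarrow> 'a) \<Rightarrow> 'i \<Rightarrow> 'i \<Rightarrow> 'a"
  where "end_mult G I P T S = (\<lambda>i j. \<Sum>l\<in>I. T i l * twist G (P i + P l) (S l j))"

text \<open>The action \<open>(a \<otimes> X)(b \<otimes> w) = (-1)^(p(X) p(b)) (ab \<otimes> X(w))\<close> on \<open>A \<otimes> W\<close>.\<close>

definition end_act ::
    "(bit \<Rightarrow> 'a::ring set) \<Rightarrow> 'i set \<Rightarrow> ('i \<Rightarrow> bit) \<Rightarrow> ('i \<Rightarrow> 'i \<Rightarrow> 'a) \<Rightarrow> ('i \<Rightarrow> 'a) \<Rightarrow> 'i \<Rightarrow> 'a"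
  where "end_act G I P T v = (\<lambda>i. \<Sum>j\<in>I. T i j * twist G (P i + P j) (v j))"

text \<open>
  \<^bold>\<open>End\<close>\<open>(W)(A)\<close> is an algebra over the commutative ring \<open>G 0\<close> of even scalars, and
  \<open>\<langle>S\<rangle>\<^sub>A\<close> is the unital \<open>G 0\<close>-subalgebra generated by \<open>S\<close>.  The ring of scalars matters: for the
  purely even \<open>A = k[x]\<close>, all elements of \<^bold>\<open>GL\<close>\<open>(1|0)(A)\<close> are constants, so that they do not generate
  \<^bold>\<open>End\<close>\<open>(k)(A) = k[x]\<close> over \<open>k\<close>, only over \<open>A\<close>.
\<close>

definition is_subalgebra ::
    "(bit \<Rightarrow> 'a::{ring, monoid_mult} set) \<Rightarrow> 'i set \<Rightarrow> ('i \<Rightarrow> bit) \<Rightarrow> ('i \<Rightarrow> 'i \<Rightarrow> 'a) set \<Rightarrow> bool"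
  where "is_subalgebra G I P B \<longleftrightarrow>
    B \<subseteq> EndA G I P \<and> end_one I \<in> B \<and>
    (\<forall>S\<in>B. \<forall>T\<in>B. (\<lambda>i j. S i j + T i j) \<in> B) \<and>
    (\<forall>a\<in>G 0. \<forall>T\<in>B. (\<lambda>i j. a * T i j) \<in> B) \<and>
    (\<forall>S\<in>B. \<forall>T\<in>B. end_mult G I P S T \<in> B)"

definition gen_subalgebra ::
    "(bit \<Rightarrow> 'a::{ring, monoid_mult} set) \<Rightarrow> 'i set \<Rightarrow> ('i \<Rightarrow> bit) \<Rightarrow> ('i \<Rightarrow> 'i \<Rightarrow> 'a) set \<Rightarrow> ('i \<Rightarrow> 'i \<Rightarrow> 'a) set"
  where "gen_subalgebra G I P S = is_subalgebra G I P hull S"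


section \<open>The superspace \<open>V = k\<^sup>m\<^sup>|\<^sup>n\<close> and its tensor powers\<close>

definition idxV :: "nat \<Rightarrow> nat \<Rightarrow> nat set"
  where "idxV m n = {..<m + n}"

definition parV :: "nat \<Rightarrow> nat \<Rightarrow> bit"
  where "parV m i = (if i < m then 0 else 1)"

text \<open>The word \<open>[i\<^sub>1, \<dots>, i\<^sub>r]\<close> indexes the basis vector \<open>e\<^bsub>i\<^sub>1\<^esub> \<otimes> \<dots> \<otimes> e\<^bsub>i\<^sub>r\<^esub>\<close> of \<open>T\<^sup>r(V)\<close>.\<close>

definition idxT :: "nat \<Rightarrow> nat \<Rightarrow> nat \<Rightarrow> nat list set"
  where "idxT m n r = {is. length is = r \<and> set is \<subseteq> idxV m n}"

definition parT :: "nat \<Rightarrow> nat list \<Rightarrow> bit"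
  where "parT m is = (\<Sum>i\<leftarrow>is. parV m i)"


section \<open>The action of \<^bold>\<open>GL\<close>\<open>(m|n)\<close>\<close>

text \<open>Automorphisms of the (left) \<open>A\<close>-supermodule \<open>A \<otimes> V\<close>; the values outside \<open>A \<otimes> V\<close> play no role.\<close>

definition GL ::
    "(bit \<Rightarrow> 'a::ring set) \<Rightarrow> nat \<Rightarrow> nat \<Rightarrow> ((nat \<Rightarrow> 'a) \<Rightarrow> nat \<Rightarrow> 'a) set"
  where "GL G m n = {g.
    bij_betw g (ext_space (idxV m n)) (ext_space (idxV m n)) \<and>
    (\<forall>v\<in>ext_space (idxV m n). \<forall>w\<in>ext_space (idxV m n). g (\<lambda>i. v i + w i) = (\<lambda>i. g v i + g w i)) \<and>
    (\<forall>a. \<forall>v\<in>ext_space (idxV m n). g (\<lambda>i. a * v i) = (\<lambda>i. a * g v i)) \<and>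
    (\<forall>q. \<forall>v\<in>ext_part G (idxV m n) (parV m) q. g v \<in> ext_part G (idxV m n) (parV m) q)}"

text \<open>
  The element \<open>v\<^sub>1 \<otimes> \<dots> \<otimes> v\<^sub>r\<close> of the \<open>r\<close>-fold tensor product of \<open>A \<otimes> V\<close> over \<open>A\<close>, read in
  \<open>A \<otimes> T\<^sup>r(V)\<close>: moving the coefficients to the left,
  \<open>(a \<otimes> e\<^sub>i) \<otimes> (b \<otimes> e') = (-1)^(p(e\<^sub>i) p(b)) (ab \<otimes> (e\<^sub>i \<otimes> e'))\<close>.
\<close>

fun tensA :: "(bit \<Rightarrow> 'a::{ring, monoid_mult} set) \<Rightarrow> nat \<Rightarrow> (nat \<Rightarrow> 'a) list \<Rightarrow> nat list \<Rightarrow> 'a"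
  where
    "tensA G m [] [] = 1"
  | "tensA G m (v # vs) (i # is) = v i * twist G (parV m i) (tensA G m vs is)"
  | "tensA G m _ _ = 0"

text \<open>
  \<open>rho G m n r g\<close> is the element of \<^bold>\<open>End\<close>\<open>(T\<^sup>r(V))(A)\<close> whose action is
  \<open>e\<^bsub>j\<^sub>1\<^esub> \<otimes> \<dots> \<otimes> e\<^bsub>j\<^sub>r\<^esub> \<mapsto> g(e\<^bsub>j\<^sub>1\<^esub>) \<otimes> \<dots> \<otimes> g(e\<^bsub>j\<^sub>r\<^esub>)\<close>; the formula for arbitrary \<open>v\<^sub>1, \<dots>, v\<^sub>r\<close> in
  \<open>A \<otimes> V\<close> is \<open>rho_tensor\<close> below.
\<close>

definition rho ::
    "(bit \<Rightarrow> 'a::{ring, monoid_mult} set) \<Rightarrow> nat \<Rightarrow> nat \<Rightarrow> nat \<Rightarrow>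
     ((nat \<Rightarrow> 'a) \<Rightarrow> nat \<Rightarrow> 'a) \<Rightarrow> nat list \<Rightarrow> nat list \<Rightarrow> 'a"
  where "rho G m n r g = (\<lambda>is js.
    if is \<in> idxT m n r \<and> js \<in> idxT m n r then tensA G m (map (\<lambda>j. g (unit_vec j)) js) is else 0)"


section \<open>The action of \<open>gl(m|n)\<close>\<close>

text \<open>Over \<open>k\<close>, endomorphisms are matrices \<open>X\<close> with \<open>X(e\<^sub>j)\<close> the sum of the \<open>X i j * e\<^sub>i\<close>.\<close>

definition mat_app :: "'i set \<Rightarrow> ('i \<Rightarrow> 'i \<Rightarrow> 'k::field) \<Rightarrow> ('i \<Rightarrow> 'k) \<Rightarrow> 'i \<Rightarrow> 'k"
  where "mat_app I X v = (\<lambda>i. \<Sum>j\<in>I. X i j * v j)"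

definition mat_space :: "'i set \<Rightarrow> ('i \<Rightarrow> 'i \<Rightarrow> 'k::field) set"
  where "mat_space I = {X. \<forall>i j. i \<notin> I \<or> j \<notin> I \<longrightarrow> X i j = 0}"

definition mat_part :: "('i \<Rightarrow> bit) \<Rightarrow> bit \<Rightarrow> ('i \<Rightarrow> 'i \<Rightarrow> 'k::field) \<Rightarrow> 'i \<Rightarrow> 'i \<Rightarrow> 'k"
  where "mat_part P p X = (\<lambda>i j. if P i + P j = p then X i j else 0)"

definition tensK :: "(nat \<Rightarrow> 'k::field) list \<Rightarrow> nat list \<Rightarrow> 'k"
  where "tensK vs is = (if length is = length vs then \<Prod>l<length vs. (vs ! l) (is ! l) else 0)"

text \<open>
  \<open>theta_hom m n r p X\<close> is \<open>\<theta>\<^sub>r(X)\<close> for \<open>X\<close> of parity \<open>p\<close>, given by its values on the basis vectors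
  \<open>e\<^bsub>j\<^sub>1\<^esub> \<otimes> \<dots> \<otimes> e\<^bsub>j\<^sub>r\<^esub>\<close>; the formula for arbitrary homogeneous \<open>v\<^sub>1, \<dots>, v\<^sub>r\<close> is \<open>theta_tensor\<close> below.
  Positions are counted from \<open>0\<close>.
\<close>

definition theta_hom ::
    "nat \<Rightarrow> nat \<Rightarrow> nat \<Rightarrow> bit \<Rightarrow> (nat \<Rightarrow> nat \<Rightarrow> 'k::field) \<Rightarrow> nat list \<Rightarrow> nat list \<Rightarrow> 'k"
  where "theta_hom m n r p X = (\<lambda>is js.
    if is \<in> idxT m n r \<and> js \<in> idxT m n r then
      \<Sum>l<r. ksign (p * of_nat (card {s. s < l \<and> parV m (js ! s) = 1}))
               (tensK ((map unit_vec js)[l := mat_app (idxV m n) X (unit_vec (js ! l))]) is)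
    else 0)"

definition theta ::
    "nat \<Rightarrow> nat \<Rightarrow> nat \<Rightarrow> (nat \<Rightarrow> nat \<Rightarrow> 'k::field) \<Rightarrow> nat list \<Rightarrow> nat list \<Rightarrow> 'k"
  where "theta m n r X = (\<lambda>is js.
    theta_hom m n r 0 (mat_part (parV m) 0 X) is js + theta_hom m n r 1 (mat_part (parV m) 1 X) is js)"

text \<open>The element \<open>a \<otimes> X\<close> of \<open>A \<otimes> End(W)\<close>.\<close>

definition end_tensor :: "('k \<Rightarrow> 'a \<Rightarrow> 'a) \<Rightarrow> 'a \<Rightarrow> ('i \<Rightarrow> 'i \<Rightarrow> 'k) \<Rightarrow> 'i \<Rightarrow> 'i \<Rightarrow> 'a"
  where "end_tensor scale a X = (\<lambda>i j. scale (X i j) a)"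

definition elem_mat :: "'i \<Rightarrow> 'i \<Rightarrow> 'i \<Rightarrow> 'i \<Rightarrow> 'k::field"
  where "elem_mat i j = (\<lambda>s t. if s = i \<and> t = j then 1 else 0)"

text \<open>\<open>\<theta>\<^bsub>r,A\<^esub>(a \<otimes> X) = a \<otimes> \<theta>\<^sub>r(X)\<close>, applied to \<open>T\<close> written as the sum of the \<open>T i j \<otimes> E\<^sub>i\<^sub>j\<close>;
  see \<open>thetaA_tensor\<close> below for arbitrary \<open>X\<close>.\<close>

definition thetaA ::
    "('k::field \<Rightarrow> 'a::{ring, monoid_mult} \<Rightarrow> 'a) \<Rightarrow> nat \<Rightarrow> nat \<Rightarrow> nat \<Rightarrow>
     (nat \<Rightarrow> nat \<Rightarrow> 'a) \<Rightarrow> nat list \<Rightarrow> nat list \<Rightarrow> 'a"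
  where "thetaA scale m n r T = (\<lambda>is js. \<Sum>i\<in>idxV m n. \<Sum>j\<in>idxV m n.
    end_tensor scale (T i j) (theta m n r (elem_mat i j)) is js)"

definition gl :: "(bit \<Rightarrow> 'a::ring set) \<Rightarrow> nat \<Rightarrow> nat \<Rightarrow> (nat \<Rightarrow> nat \<Rightarrow> 'a) set"
  where "gl G m n = EndA G (idxV m n) (parV m)"


section \<open>The defining formulas hold for arbitrary arguments\<close>

declare add_bit_eq_xor [simp del] mult_bit_eq_and [simp del]

lemma bit_add_self [simp]: "(p::bit) + p = 0"
  by (cases p) simp_all

lemma bit_add_self_left [simp]: "(p::bit) + (p + q) = q"
  by (cases p; cases q) simp_all

lemma bit_add_cancel: "(a::bit) + b + (b + c) = a + c"
  by (cases a; cases b; cases c) simp_all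

lemma bit_add_swap: "(a::bit) + b + (c + d) = a + c + (b + d)"
  by (cases a; cases b; cases c; cases d) simp_all

lemma ksign_0 [simp]: "ksign 0 x = x" and ksign_1 [simp]: "ksign 1 x = - x"
  by (simp_all add: ksign_def)

context comm_superalgebra
begin

lemma part_zero [simp]: "0 \<in> G p"
  using subspace_part subspace_0 by blast

lemma part_add: "x \<in> G p \<Longrightarrow> y \<in> G p \<Longrightarrow> x + y \<in> G p"
  using subspace_part subspace_add by blast

lemma part_neg: "x \<in> G p \<Longrightarrow> - x \<in> G p"
  using subspace_part subspace_neg by blast

lemma part_diff: "x \<in> G p \<Longrightarrow> y \<in> G p \<Longrightarrow> x - y \<in> G p"
  using subspace_part subspace_diff by blast

lemma part_scale: "x \<in> G p \<Longrightarrow> scale c x \<in> G p"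
  using subspace_part subspace_scale by blast

lemma part_sum: "(\<And>i. i \<in> I \<Longrightarrow> f i \<in> G p) \<Longrightarrow> sum f I \<in> G p"
  using subspace_part subspace_sum by blast

lemma hcomp_ex1: "\<exists>!y. y \<in> G p \<and> x - y \<in> G (p + 1)"
proof -
  obtain z where z: "fst z \<in> G 0" "snd z \<in> G 1" "x = fst z + snd z"
    and u: "\<And>w. fst w \<in> G 0 \<and> snd w \<in> G 1 \<and> x = fst w + snd w \<Longrightarrow> w = z"
    using direct_sum[of x] by blast
  show ?thesis
  proof (cases p)
    case zero
    show ?thesis
    proof (rule ex1I[of _ "fst z"])
      show "y = fst z" if "y \<in> G p \<and> x - y \<in> G (p + 1)" for y
        using u[of "(y, x - y)"] that zero by auto
    qed (use z zero in auto)
  next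
    case one
    show ?thesis
    proof (rule ex1I[of _ "snd z"])
      show "y = snd z" if "y \<in> G p \<and> x - y \<in> G (p + 1)" for y
        using u[of "(x - y, y)"] that one by auto
    qed (use z one in auto)
  qed
qed

lemma hcomp_eq: "y \<in> G p \<Longrightarrow> x - y \<in> G (p + 1) \<Longrightarrow> hcomp G p x = y"
  unfolding hcomp_def using hcomp_ex1 by (intro the1_equality) auto

lemma hcomp_part: "hcomp G p x \<in> G p" and hcomp_compl: "x - hcomp G p x \<in> G (p + 1)"
  using theI'[OF hcomp_ex1[of p x]] unfolding hcomp_def by auto

lemma hcomp_add: "hcomp G p (x + y) = hcomp G p x + hcomp G p y"
proof (rule hcomp_eq)
  show "x + y - (hcomp G p x + hcomp G p y) \<in> G (p + 1)"
    using part_add[OF hcomp_compl[of x p] hcomp_compl[of y p]] by (simp add: algebra_simps)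
qed (simp add: part_add hcomp_part)

lemma hcomp_hom: "x \<in> G q \<Longrightarrow> hcomp G p x = (if p = q then x else 0)"
  by (cases p; cases q) (auto intro!: hcomp_eq)

lemma hcomp_split: "x = hcomp G 0 x + hcomp G 1 x"
proof -
  have "hcomp G 1 x = x - hcomp G 0 x"
    using hcomp_part[of 0 x] hcomp_compl[of x 0] by (intro hcomp_eq) auto
  then show ?thesis by simp
qed

lemma twist_0 [simp]: "twist G 0 x = x"
  by (simp add: twist_def)

lemma twist_hom: "x \<in> G q \<Longrightarrow> twist G p x = ksign (p * q) x"
  by (cases p; cases q) (auto simp: twist_def hcomp_hom)

lemma twist_part: "x \<in> G q \<Longrightarrow> twist G p x \<in> G q"
  by (cases p; cases q) (auto simp: twist_hom part_neg)

lemma twist_add: "twist G p (x + y) = twist G p x + twist G p y"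
  by (simp add: twist_def hcomp_add)

lemma twist_zero [simp]: "twist G p 0 = 0"
  using twist_add[of p 0 0] by simp

lemma twist_one [simp]: "twist G p 1 = 1"
  using twist_hom[OF one_even, of p] by simp

lemma twist_sum: "twist G p (sum f I) = (\<Sum>i\<in>I. twist G p (f i))"
  by (induction I rule: infinite_finite_induct) (simp_all add: twist_add)

text \<open>An additive identity need only be checked on homogeneous elements.\<close>

lemma hom_induct:
  fixes f g :: "'a \<Rightarrow> 'a"
  assumes "\<And>q x. x \<in> G q \<Longrightarrow> f x = g x"
    and "\<And>x y. f (x + y) = f x + f y" and "\<And>x y. g (x + y) = g x + g y"
  shows "f x = g x"
proof -
  have "f (hcomp G 0 x + hcomp G 1 x) = g (hcomp G 0 x + hcomp G 1 x)"
    using assms(1)[OF hcomp_part] by (simp only: assms(2,3))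
  then show ?thesis by (simp only: hcomp_split[symmetric])
qed

lemma twist_mult: "twist G p (x * y) = twist G p x * twist G p y"
proof (rule hom_induct[of "\<lambda>x. twist G p (x * y)" "\<lambda>x. twist G p x * twist G p y"])
  fix q x assume x: "x \<in> G q"
  show "twist G p (x * y) = twist G p x * twist G p y"
  proof (rule hom_induct[of "\<lambda>y. twist G p (x * y)" "\<lambda>y. twist G p x * twist G p y"])
    fix q' y assume y: "y \<in> G q'"
    show "twist G p (x * y) = twist G p x * twist G p y"
      using twist_hom[OF x, of p] twist_hom[OF y, of p] twist_hom[OF mult_part[OF x y], of p]
      by (cases p; cases q; cases q') auto
  qed (simp_all add: twist_add distrib_left)
qed (simp_all add: twist_add distrib_right)

lemma twist_twist: "twist G p (twist G q x) = twist G (p + q) x"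
proof (rule hom_induct[of "\<lambda>x. twist G p (twist G q x)" "\<lambda>x. twist G (p + q) x"])
  fix t x assume x: "x \<in> G t"
  show "twist G p (twist G q x) = twist G (p + q) x"
    using twist_hom[OF x, of "p + q"] twist_hom[OF x, of q] twist_hom[OF twist_part[OF x, of q], of p]
    by (cases p; cases q; cases t) auto
qed (simp_all add: twist_add)

lemma twist_commute: "x \<in> G p \<Longrightarrow> x * twist G p y = y * x"
proof (rule hom_induct[of "\<lambda>y. x * twist G p y" "\<lambda>y. y * x"])
  fix q y assume x: "x \<in> G p" and y: "y \<in> G q"
  show "x * twist G p y = y * x"
    using twist_hom[OF y, of p] supercommute[OF x y] by (cases p; cases q) auto
qed (simp_all add: twist_add distrib_left distrib_right)

lemma end_act_mult: "end_act G I P (end_mult G I P S T) v = end_act G I P S (end_act G I P T v)"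
proof
  fix i
  have eq: "P i + P l + (P l + P j) = P i + P j" for l j
    by (rule bit_add_cancel)
  have "end_act G I P (end_mult G I P S T) v i
      = (\<Sum>j\<in>I. \<Sum>l\<in>I. S i l * twist G (P i + P l) (T l j) * twist G (P i + P j) (v j))"
    by (simp add: end_act_def end_mult_def sum_distrib_right)
  also have "\<dots> = (\<Sum>l\<in>I. \<Sum>j\<in>I. S i l * twist G (P i + P l) (T l j) * twist G (P i + P j) (v j))"
    by (rule sum.swap)
  also have "\<dots> = end_act G I P S (end_act G I P T v) i"
    by (simp add: end_act_def sum_distrib_left twist_sum twist_mult twist_twist eq mult.assoc)
  finally show "end_act G I P (end_mult G I P S T) v i = end_act G I P S (end_act G I P T v) i" .
qed

lemma finite_idxV [simp]: "finite (idxV m n)"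
  by (simp add: idxV_def)

lemma unit_vec_part: "i \<in> I \<Longrightarrow> unit_vec i \<in> ext_part G I P (P i)"
  by (auto simp: ext_part_def ext_space_def unit_vec_def one_even)

lemma GL_expand:
  assumes "g \<in> GL G m n" "v \<in> ext_space (idxV m n)"
  shows "g v j = (\<Sum>i\<in>idxV m n. v i * g (unit_vec i) j)"
proof -
  let ?I = "idxV m n"
  have add: "g (\<lambda>i. v i + w i) = (\<lambda>i. g v i + g w i)"
    if "v \<in> ext_space ?I" "w \<in> ext_space ?I" for v w
    using assms(1) that by (auto simp: GL_def)
  have scal: "g (\<lambda>i. a * v i) = (\<lambda>i. a * g v i)" if "v \<in> ext_space ?I" for a v
    using assms(1) that by (auto simp: GL_def)
  have "g (\<lambda>i. if i \<in> J then v i else 0) j = (\<Sum>i\<in>J. v i * g (unit_vec i) j)"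
    if "finite J" "J \<subseteq> ?I" for J
    using that
  proof (induction J)
    case empty
    have "g (\<lambda>i. 0 * (0::'a)) = (\<lambda>i. 0 * g (\<lambda>i. 0) i)"
      by (rule scal) (simp add: ext_space_def)
    then show ?case by simp
  next
    case (insert x J)
    have ux: "unit_vec x \<in> ext_space ?I"
      using insert.prems by (auto simp: ext_space_def unit_vec_def)
    have "(\<lambda>i. if i \<in> insert x J then v i else 0)
        = (\<lambda>i. v x * unit_vec x i + (if i \<in> J then v i else 0))"
      using insert.hyps by (auto simp: unit_vec_def)
    moreover have "g (\<lambda>i. v x * unit_vec x i + (if i \<in> J then v i else 0))
        = (\<lambda>i. g (\<lambda>i. v x * unit_vec x i) i + g (\<lambda>i. if i \<in> J then v i else 0) i)"
      using insert.prems by (intro add) (auto simp: ext_space_def unit_vec_def)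
    ultimately show ?case
      using insert scal[OF ux] by simp
  qed
  moreover have "(\<lambda>i. if i \<in> ?I then v i else 0) = v"
    using assms(2) by (auto simp: ext_space_def)
  ultimately show ?thesis
    by (metis finite_idxV subset_refl)
qed

lemma GL_unit_vec:
  assumes "g \<in> GL G m n" "j \<in> idxV m n"
  shows "g (unit_vec j) \<in> ext_part G (idxV m n) (parV m) (parV m j)"
  using assms unit_vec_part[of j "idxV m n" "parV m"] unfolding GL_def by blast

lemma GL_unit_part: "g \<in> GL G m n \<Longrightarrow> j \<in> idxV m n \<Longrightarrow> i \<in> idxV m n \<Longrightarrow>
    g (unit_vec j) i \<in> G (parV m i + parV m j)"
  using GL_unit_vec[of g m n j] by (simp add: ext_part_def add.commute)

lemma GL_unit_outside: "g \<in> GL G m n \<Longrightarrow> j \<in> idxV m n \<Longrightarrow> i \<notin> idxV m n \<Longrightarrow> g (unit_vec j) i = 0"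
  using GL_unit_vec[of g m n j] by (simp add: ext_part_def ext_space_def)

lemma tensA_length: "length is \<noteq> length vs \<Longrightarrow> tensA G m vs is = 0"
proof (induction vs arbitrary: "is")
  case Nil
  then show ?case by (cases "is") simp_all
next
  case (Cons v vs)
  then show ?case by (cases "is") simp_all
qed

lemma tensA_outside: "\<forall>v\<in>set vs. v \<in> ext_space I \<Longrightarrow> \<not> set is \<subseteq> I \<Longrightarrow> tensA G m vs is = 0"
proof (induction vs arbitrary: "is")
  case Nil
  then show ?case by (cases "is") simp_all
next
  case (Cons v vs)
  show ?case
  proof (cases "is")
    case (Cons i is')
    with Cons.prems Cons.IH[of is'] show ?thesis
      by (cases "i \<in> I") (auto simp: ext_space_def)
  qed simp
qed

lemma parT_Nil [simp]: "parT m [] = 0" and parT_Cons [simp]: "parT m (i # is) = parV m i + parT m is"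
  by (simp_all add: parT_def)

lemma tensA_GL_part:
  assumes "g \<in> GL G m n" "set js \<subseteq> idxV m n" "set is \<subseteq> idxV m n"
  shows "tensA G m (map (\<lambda>j. g (unit_vec j)) js) is \<in> G (parT m is + parT m js)"
  using assms(2,3)
proof (induction js arbitrary: "is")
  case Nil
  then show ?case by (cases "is") (auto simp: one_even)
next
  case (Cons j js)
  show ?case
  proof (cases "is")
    case (Cons i is')
    have t: "tensA G m (map (\<lambda>j. g (unit_vec j)) js) is' \<in> G (parT m is' + parT m js)"
      using Cons Cons.prems by (intro Cons.IH) auto
    have "g (unit_vec j) i * twist G (parV m i) (tensA G m (map (\<lambda>j. g (unit_vec j)) js) is')
        \<in> G ((parV m i + parV m j) + (parT m is' + parT m js))"
      using Cons Cons.prems by (intro mult_part[OF GL_unit_part[OF assms(1)] twist_part[OF t]]) auto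
    moreover have "parV m i + parV m j + (parT m is' + parT m js) = parT m is + parT m (j # js)"
      unfolding Cons parT_Cons by (rule bit_add_swap)
    ultimately show ?thesis by (simp add: Cons)
  qed auto
qed

lemma rho_EndA: "g \<in> GL G m n \<Longrightarrow> rho G m n r g \<in> EndA G (idxT m n r) (parT m)"
  using tensA_GL_part by (auto simp: EndA_def rho_def idxT_def)

end

lemma idxT_0: "idxT m n 0 = {[]}"
  by (auto simp: idxT_def)

lemma idxT_Suc: "idxT m n (Suc r) = (\<lambda>(i, is). i # is) ` (idxV m n \<times> idxT m n r)"
  by (force simp: idxT_def length_Suc_conv)

lemma sum_idxT_Suc:
  "(\<Sum>is\<in>idxT m n (Suc r). f is) = (\<Sum>i\<in>idxV m n. \<Sum>is\<in>idxT m n r. f (i # is))"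
proof -
  have "inj_on (\<lambda>(i, is). i # is) (idxV m n \<times> idxT m n r)"
    by (auto simp: inj_on_def)
  then show ?thesis
    by (simp add: idxT_Suc sum.reindex sum.cartesian_product case_prod_unfold)
qed

context comm_superalgebra
begin

theorem rho_tensor:
  assumes g: "g \<in> GL G m n" and vs: "length vs = r" "\<forall>v\<in>set vs. v \<in> ext_space (idxV m n)"
  shows "end_act G (idxT m n r) (parT m) (rho G m n r g) (tensA G m vs) = tensA G m (map g vs)"
proof
  fix "is"
  have gv: "g v \<in> ext_space (idxV m n)" if "v \<in> ext_space (idxV m n)" for v
    using g that by (auto simp: GL_def bij_betw_def)
  show "end_act G (idxT m n r) (parT m) (rho G m n r g) (tensA G m vs) is = tensA G m (map g vs) is"
  proof (cases "is \<in> idxT m n r")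
    case False
    then have "tensA G m (map g vs) is = 0"
      using tensA_length[of "is" "map g vs"] tensA_outside[of "map g vs" "idxV m n" "is"] vs gv
      by (auto simp: idxT_def)
    with False show ?thesis by (simp add: end_act_def rho_def)
  next
    case True
    let ?E = "\<lambda>is js. tensA G m (map (\<lambda>j. g (unit_vec j)) js) is"
    have "(\<Sum>js\<in>idxT m n r. ?E is js * twist G (parT m is + parT m js) (tensA G m vs js))
        = tensA G m (map g vs) is"
      using vs True
    proof (induction vs arbitrary: r "is")
      case Nil
      then have "r = 0" "is = []" by (auto simp: idxT_def)
      then show ?case by (simp add: idxT_0)
    next
      case (Cons v vs)
      obtain r' where r: "r = Suc r'" using Cons.prems by auto
      obtain i is' where i: "is = i # is'" "i \<in> idxV m n" "is' \<in> idxT m n r'"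
        using Cons.prems by (auto simp: r idxT_Suc)
      have step: "?E (i # is') (j # js)
            * twist G (parT m (i # is') + parT m (j # js)) (tensA G m (v # vs) (j # js))
          = v j * g (unit_vec j) i
            * twist G (parV m i) (?E is' js * twist G (parT m is' + parT m js) (tensA G m vs js))"
        if j: "j \<in> idxV m n" "js \<in> idxT m n r'" for j js
      proof -
        let ?d = "parV m i + parV m j + (parT m is' + parT m js)"
        let ?h = "g (unit_vec j) i * twist G (parV m i) (?E is' js)"
        let ?t = "tensA G m vs js"
        have h: "?h \<in> G ?d"
          using j i by (intro mult_part GL_unit_part[OF g] twist_part tensA_GL_part[OF g])
            (auto simp: idxT_def)
        have "?h * twist G ?d (v j * twist G (parV m j) ?t)
            = (?h * twist G ?d (v j)) * twist G (?d + parV m j) ?t"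
          by (simp add: twist_mult twist_twist mult.assoc)
        also have "\<dots> = v j * ?h * twist G (?d + parV m j) ?t"
          by (simp add: twist_commute[OF h])
        also have "?d + parV m j = parV m i + (parT m is' + parT m js)"
          by (cases "parV m i"; cases "parV m j"; cases "parT m is'"; cases "parT m js") simp_all
        finally show ?thesis
          unfolding parT_Cons tensA.simps list.map bit_add_swap[of "parV m i" "parT m is'"]
          by (simp only: twist_mult twist_twist mult.assoc)
      qed
      have "(\<Sum>js\<in>idxT m n r. ?E is js * twist G (parT m is + parT m js) (tensA G m (v # vs) js))
          = (\<Sum>j\<in>idxV m n. \<Sum>js\<in>idxT m n r'. v j * g (unit_vec j) i
            * twist G (parV m i) (?E is' js * twist G (parT m is' + parT m js) (tensA G m vs js)))"
        unfolding r i sum_idxT_Suc by (intro sum.cong refl step)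
      also have "\<dots> = (\<Sum>j\<in>idxV m n. v j * g (unit_vec j) i) * twist G (parV m i) (tensA G m (map g vs) is')"
        using Cons.IH[of r' is'] Cons.prems i
        by (simp add: r flip: sum_distrib_left sum_distrib_right twist_sum)
      also have "(\<Sum>j\<in>idxV m n. v j * g (unit_vec j) i) = g v i"
        using GL_expand[OF g, of v i] Cons.prems by simp
      finally show ?case by (simp add: i)
    qed
    with True show ?thesis by (simp add: end_act_def rho_def)
  qed
qed

end

lemma tensK_update:
  assumes "l < length us" "length is = length us"
  shows "tensK (us[l := v]) is = v (is ! l) * (\<Prod>s\<in>{..<length us} - {l}. (us ! s) (is ! s))"
proof -
  have "tensK (us[l := v]) is = (\<Prod>s<length us. (us[l := v] ! s) (is ! s))"
    using assms by (simp add: tensK_def)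
  also have "\<dots> = v (is ! l) * (\<Prod>s\<in>{..<length us} - {l}. (us[l := v] ! s) (is ! s))"
    using assms by (subst prod.remove[of _ l]) auto
  also have "(\<Prod>s\<in>{..<length us} - {l}. (us[l := v] ! s) (is ! s))
      = (\<Prod>s\<in>{..<length us} - {l}. (us ! s) (is ! s))"
    by (intro prod.cong) auto
  finally show ?thesis .
qed

lemma mat_app_unit_vec: "finite I \<Longrightarrow> j \<in> I \<Longrightarrow> mat_app I X (unit_vec j) i = X i j"
  by (simp add: mat_app_def unit_vec_def if_distrib sum.delta cong: if_cong)

lemma idxT_nth: "is \<in> idxT m n r \<Longrightarrow> l < r \<Longrightarrow> is ! l \<in> idxV m n"
  using nth_mem by (fastforce simp: idxT_def)

lemma theta_hom_entry:
  assumes "is \<in> idxT m n r" "js \<in> idxT m n r"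
  shows "theta_hom m n r p X is js =
    (\<Sum>l<r. ksign (p * of_nat (card {s. s < l \<and> parV m (js ! s) = 1}))
      (X (is ! l) (js ! l) * (\<Prod>s\<in>{..<r} - {l}. unit_vec (js ! s) (is ! s))))"
proof -
  have len: "length is = r" "length js = r" using assms by (auto simp: idxT_def)
  have "tensK ((map unit_vec js)[l := mat_app (idxV m n) X (unit_vec (js ! l))]) is
      = X (is ! l) (js ! l) * (\<Prod>s\<in>{..<r} - {l}. unit_vec (js ! s) (is ! s))" if l: "l < r" for l
  proof -
    have "mat_app (idxV m n) X (unit_vec (js ! l)) (is ! l) = X (is ! l) (js ! l)"
      using idxT_nth[OF assms(2) l] by (intro mat_app_unit_vec) (simp_all add: idxV_def)
    moreover have "(\<Prod>s\<in>{..<r} - {l}. (map unit_vec js ! s) (is ! s))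
        = (\<Prod>s\<in>{..<r} - {l}. (unit_vec (js ! s) (is ! s) :: 'a))"
      using len by (intro prod.cong) auto
    ultimately show ?thesis using l len by (simp add: tensK_update)
  qed
  then show ?thesis using assms by (simp add: theta_hom_def)
qed

lemma ksign_zero [simp]: "ksign p (0::'a::group_add) = 0"
  by (simp add: ksign_def)

lemma theta_entry:
  assumes "is \<in> idxT m n r" "js \<in> idxT m n r"
  shows "theta m n r X is js =
    (\<Sum>l<r. ksign ((parV m (is ! l) + parV m (js ! l)) * of_nat (card {s. s < l \<and> parV m (js ! s) = 1}))
      (X (is ! l) (js ! l) * (\<Prod>s\<in>{..<r} - {l}. unit_vec (js ! s) (is ! s))))"
proof -
  have split: "ksign (0 * d) (mat_part P 0 X i j * c) + ksign (1 * d) (mat_part P 1 X i j * c)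
      = ksign ((P i + P j) * d) (X i j * c)" for P :: "nat \<Rightarrow> bit" and d :: bit and i j c
    by (cases "P i + P j") (auto simp: mat_part_def)
  show ?thesis
    unfolding theta_def theta_hom_entry[OF assms] sum.distrib[symmetric]
    by (intro sum.cong refl split)
qed

lemma theta_outside: "is \<notin> idxT m n r \<or> js \<notin> idxT m n r \<Longrightarrow> theta m n r X is js = 0"
  by (auto simp: theta_def theta_hom_def)

lemma theta_expand:
  assumes "X \<in> mat_space (idxV m n)"
  shows "theta m n r X is js =
    (\<Sum>i\<in>idxV m n. \<Sum>j\<in>idxV m n. X i j * theta m n r (elem_mat i j) is js)"
proof (cases "is \<in> idxT m n r \<and> js \<in> idxT m n r")
  case False
  then show ?thesis by (simp add: theta_outside)
next
  case True
  let ?I = "idxV m n"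
  have fin: "finite ?I" by (simp add: idxV_def)
  define c :: "nat \<Rightarrow> 'a" where "c l = ksign ((parV m (is ! l) + parV m (js ! l)) *
    of_nat (card {s. s < l \<and> parV m (js ! s) = 1})) (\<Prod>s\<in>{..<r} - {l}. unit_vec (js ! s) (is ! s))" for l
  have entry: "theta m n r Y is js = (\<Sum>l<r. Y (is ! l) (js ! l) * c l)" for Y
    unfolding theta_entry[OF conjunct1[OF True] conjunct2[OF True]] c_def
    by (intro sum.cong refl) (simp add: ksign_def)
  have ex: "(\<Sum>i\<in>?I. \<Sum>j\<in>?I. X i j * elem_mat i j s t) = X s t" if "s \<in> ?I" "t \<in> ?I" for s t
  proof -
    have "(\<Sum>i\<in>?I. \<Sum>j\<in>?I. X i j * elem_mat i j s t)
        = (\<Sum>i\<in>?I. if i = s then (\<Sum>j\<in>?I. if j = t then X i j else 0) else 0)"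
      by (intro sum.cong refl) (auto simp: elem_mat_def intro!: sum.cong)
    then show ?thesis using fin that by simp
  qed
  have "(\<Sum>i\<in>?I. \<Sum>j\<in>?I. X i j * theta m n r (elem_mat i j) is js)
      = (\<Sum>i\<in>?I. \<Sum>j\<in>?I. \<Sum>l<r. X i j * elem_mat i j (is ! l) (js ! l) * c l)"
    by (simp add: entry sum_distrib_left mult.assoc)
  also have "\<dots> = (\<Sum>i\<in>?I. \<Sum>l<r. \<Sum>j\<in>?I. X i j * elem_mat i j (is ! l) (js ! l) * c l)"
    by (intro sum.cong refl sum.swap)
  also have "\<dots> = (\<Sum>l<r. \<Sum>i\<in>?I. \<Sum>j\<in>?I. X i j * elem_mat i j (is ! l) (js ! l) * c l)"
    by (rule sum.swap)
  also have "\<dots> = (\<Sum>l<r. (\<Sum>i\<in>?I. \<Sum>j\<in>?I. X i j * elem_mat i j (is ! l) (js ! l)) * c l)"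
    by (simp add: sum_distrib_right)
  also have "\<dots> = theta m n r X is js"
    unfolding entry
  proof (intro sum.cong refl)
    fix l assume "l \<in> {..<r}"
    with True have "is ! l \<in> ?I" "js ! l \<in> ?I"
      using idxT_nth[of _ m n r l] by auto
    then show "(\<Sum>i\<in>?I. \<Sum>j\<in>?I. X i j * elem_mat i j (is ! l) (js ! l)) * c l = X (is ! l) (js ! l) * c l"
      using ex by simp
  qed
  finally show ?thesis by simp
qed

lemma prod_sum_idxT:
  "(\<Sum>js\<in>idxT m n r. \<Prod>s<r. f s (js ! s)) = (\<Prod>s<r. \<Sum>j\<in>idxV m n. f s j :: 'a::field)"
proof (induction r arbitrary: f)
  case (Suc r)
  have "(\<Sum>js\<in>idxT m n (Suc r). \<Prod>s<Suc r. f s (js ! s))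
      = (\<Sum>j\<in>idxV m n. \<Sum>js\<in>idxT m n r. f 0 j * (\<Prod>s<r. f (Suc s) (js ! s)))"
    unfolding sum_idxT_Suc by (simp add: prod.lessThan_Suc_shift del: prod.lessThan_Suc)
  also have "\<dots> = (\<Sum>j\<in>idxV m n. f 0 j) * (\<Prod>s<r. \<Sum>j\<in>idxV m n. f (Suc s) j)"
    using Suc.IH[of "\<lambda>s. f (Suc s)"] by (simp flip: sum_distrib_left sum_distrib_right)
  finally show ?case
    by (simp add: prod.lessThan_Suc_shift del: prod.lessThan_Suc)
qed (simp add: idxT_0)

theorem theta_tensor:
  fixes X :: "nat \<Rightarrow> nat \<Rightarrow> 'k::field"
  assumes X: "X \<in> mat_space (idxV m n)" "mat_part (parV m) p X = X"
    and vs: "length vs = r" "\<And>l. l < r \<Longrightarrow> vs ! l \<in> ext_space (idxV m n)"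
    and qs: "\<And>l i. l < r \<Longrightarrow> (vs ! l) i \<noteq> 0 \<Longrightarrow> parV m i = qs l"
  shows "mat_app (idxT m n r) (theta m n r X) (tensK vs) is =
    (\<Sum>l<r. ksign (p * of_nat (card {s. s < l \<and> qs s = 1}))
      (tensK (vs[l := mat_app (idxV m n) X (vs ! l)]) is))"
proof (cases "is \<in> idxT m n r")
  case False
  have "tensK (vs[l := mat_app (idxV m n) X (vs ! l)]) is = 0" if l: "l < r" for l
  proof (cases "length is = r")
    case True
    with False have "\<not> set is \<subseteq> idxV m n" by (auto simp: idxT_def)
    then obtain t where t: "t < r" "is ! t \<notin> idxV m n"
      using True by (auto simp: subset_iff in_set_conv_nth)
    then have "(vs[l := mat_app (idxV m n) X (vs ! l)] ! t) (is ! t) = 0"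
      using vs(1) vs(2)[OF t(1)] X(1)
      by (cases "t = l") (auto simp: ext_space_def mat_app_def mat_space_def)
    then show ?thesis using True vs(1) t(1) by (auto simp: tensK_def)
  qed (use vs(1) in \<open>simp add: tensK_def\<close>)
  then show ?thesis using False by (simp add: mat_app_def theta_outside)
next
  case True
  let ?I = "idxV m n"
  have fin: "finite ?I" by (simp add: idxV_def)
  have len: "length is = r" using True by (simp add: idxT_def)
  let ?F = "\<lambda>l s j. (if s = l then X (is ! l) j else unit_vec j (is ! s)) * (vs ! s) j"
  let ?sg = "\<lambda>l. ksign (p * of_nat (card {s. s < l \<and> qs s = 1})) :: 'k \<Rightarrow> 'k"
  have tm: "ksign ((parV m (is ! l) + parV m (js ! l)) * of_nat (card {s. s < l \<and> parV m (js ! s) = 1}))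
        (X (is ! l) (js ! l) * (\<Prod>s\<in>{..<r} - {l}. unit_vec (js ! s) (is ! s))) * tensK vs js
      = ?sg l (\<Prod>s<r. ?F l s (js ! s))" if l: "l < r" and js: "js \<in> idxT m n r" for l js
  proof -
    have tK: "tensK vs js = (\<Prod>s<r. (vs ! s) (js ! s))"
      using js vs(1) by (simp add: tensK_def idxT_def)
    have "(\<Prod>s<r. ?F l s (js ! s))
        = (\<Prod>s<r. if s = l then X (is ! l) (js ! s) else unit_vec (js ! s) (is ! s)) * tensK vs js"
      by (simp add: prod.distrib tK)
    also have "(\<Prod>s<r. if s = l then X (is ! l) (js ! s) else unit_vec (js ! s) (is ! s))
        = X (is ! l) (js ! l) * (\<Prod>s\<in>{..<r} - {l}. unit_vec (js ! s) (is ! s))"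
      using l by (subst prod.remove[of _ l]) (auto intro!: prod.cong)
    finally have F: "(\<Prod>s<r. ?F l s (js ! s))
        = X (is ! l) (js ! l) * (\<Prod>s\<in>{..<r} - {l}. unit_vec (js ! s) (is ! s)) * tensK vs js" .
    show ?thesis
    proof (cases "tensK vs js = 0 \<or> X (is ! l) (js ! l) = 0")
      case True
      then show ?thesis unfolding F by (auto simp: ksign_def)
    next
      case False
      then have "parV m (js ! s) = qs s" if "s < r" for s
        using that qs[OF that, of "js ! s"] by (auto simp: tK)
      then have "{s. s < l \<and> parV m (js ! s) = 1} = {s. s < l \<and> qs s = 1}"
        using l by auto
      moreover have "parV m (is ! l) + parV m (js ! l) = p"
        using False X(2)[THEN fun_cong, THEN fun_cong, of "is ! l" "js ! l"]
        by (auto simp: mat_part_def split: if_splits)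
      ultimately show ?thesis unfolding F by (simp add: ksign_def)
    qed
  qed
  have "mat_app (idxT m n r) (theta m n r X) (tensK vs) is
      = (\<Sum>js\<in>idxT m n r. \<Sum>l<r. ?sg l (\<Prod>s<r. ?F l s (js ! s)))"
    unfolding mat_app_def
    by (intro sum.cong refl) (simp add: theta_entry[OF True] sum_distrib_right tm)
  also have "\<dots> = (\<Sum>l<r. \<Sum>js\<in>idxT m n r. ?sg l (\<Prod>s<r. ?F l s (js ! s)))"
    by (rule sum.swap)
  also have "\<dots> = (\<Sum>l<r. ?sg l (tensK (vs[l := mat_app ?I X (vs ! l)]) is))"
  proof (intro sum.cong refl)
    fix l assume "l \<in> {..<r}"
    then have l: "l < r" by simp
    have "(\<Sum>js\<in>idxT m n r. ?sg l (\<Prod>s<r. ?F l s (js ! s)))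
        = ?sg l (\<Sum>js\<in>idxT m n r. \<Prod>s<r. ?F l s (js ! s))"
      by (simp add: ksign_def sum_negf)
    also have "(\<Sum>js\<in>idxT m n r. \<Prod>s<r. ?F l s (js ! s)) = (\<Prod>s<r. \<Sum>j\<in>?I. ?F l s j)"
      by (rule prod_sum_idxT)
    also have "\<dots> = (\<Prod>s<r. (vs[l := mat_app ?I X (vs ! l)] ! s) (is ! s))"
    proof (intro prod.cong refl)
      fix s assume "s \<in> {..<r}"
      then have s: "s < r" by simp
      show "(\<Sum>j\<in>?I. ?F l s j) = (vs[l := mat_app ?I X (vs ! l)] ! s) (is ! s)"
      proof (cases "s = l")
        case False
        have "(\<Sum>j\<in>?I. ?F l s j) = (\<Sum>j\<in>?I. if is ! s = j then (vs ! s) j else 0)"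
          using False by (intro sum.cong) (auto simp: unit_vec_def)
        then show ?thesis using False fin idxT_nth[OF True s] by simp
      qed (use l vs(1) in \<open>simp add: mat_app_def\<close>)
    qed
    also have "\<dots> = tensK (vs[l := mat_app ?I X (vs ! l)]) is"
      using len vs(1) by (simp add: tensK_def)
    finally show "(\<Sum>js\<in>idxT m n r. ?sg l (\<Prod>s<r. ?F l s (js ! s)))
        = ?sg l (tensK (vs[l := mat_app ?I X (vs ! l)]) is)" .
  qed
  finally show ?thesis .
qed

lemma theta_elem_parity:
  assumes "theta m n r (elem_mat i j) is js \<noteq> 0"
  shows "parT m is + parT m js = parV m i + parV m j"
proof -
  have idx: "is \<in> idxT m n r" "js \<in> idxT m n r"
    using assms theta_outside[of "is" m n r js "elem_mat i j"] by auto
  then have len: "length is = r" "length js = r" by (auto simp: idxT_def)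
  obtain l where l: "l < r" and nz: "elem_mat i j (is ! l) (js ! l) \<noteq> (0::'a)"
    "(\<Prod>s\<in>{..<r} - {l}. unit_vec (js ! s) (is ! s)) \<noteq> (0::'a)"
    using assms unfolding theta_entry[OF idx]
    by (metis (no_types, lifting) ksign_zero lessThan_iff mult_zero_left mult_zero_right sum.neutral)
  have eq: "is ! s = js ! s" if "s < r" "s \<noteq> l" for s
    using nz(2) that by (auto simp: unit_vec_def split: if_splits)
  have at_l: "is ! l = i" "js ! l = j"
    using nz(1) by (auto simp: elem_mat_def split: if_splits)
  have "parT m ks = (\<Sum>s<r. parV m (ks ! s))" if "length ks = r" for ks
    using that by (simp add: parT_def sum_list_sum_nth lessThan_atLeast0)
  then have "parT m is + parT m js = (\<Sum>s<r. parV m (is ! s) + parV m (js ! s))"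
    unfolding sum.distrib using len by simp
  also have "\<dots> = (\<Sum>s<r. if s = l then parV m i + parV m j else 0)"
    using eq at_l by (intro sum.cong) auto
  also have "\<dots> = parV m i + parV m j"
    using l by simp
  finally show ?thesis .
qed

context comm_superalgebra
begin

theorem thetaA_tensor:
  assumes "X \<in> mat_space (idxV m n)"
  shows "thetaA scale m n r (end_tensor scale a X) = end_tensor scale a (theta m n r X)"
proof (intro ext)
  fix "is" js
  have "thetaA scale m n r (end_tensor scale a X) is js
      = (\<Sum>i\<in>idxV m n. \<Sum>j\<in>idxV m n. scale (X i j * theta m n r (elem_mat i j) is js) a)"
    by (simp add: thetaA_def end_tensor_def mult.commute)
  also have "\<dots> = end_tensor scale a (theta m n r X) is js"
    by (simp add: end_tensor_def theta_expand[OF assms] scale_sum_left)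
  finally show "thetaA scale m n r (end_tensor scale a X) is js = end_tensor scale a (theta m n r X) is js" .
qed

lemma thetaA_add: "thetaA scale m n r (\<lambda>i j. S i j + T i j)
    = (\<lambda>is js. thetaA scale m n r S is js + thetaA scale m n r T is js)"
  by (simp add: thetaA_def end_tensor_def scale_right_distrib sum.distrib)

lemma thetaA_EndA:
  assumes "T \<in> gl G m n"
  shows "thetaA scale m n r T \<in> EndA G (idxT m n r) (parT m)"
proof -
  have "end_tensor scale (T i j) (theta m n r (elem_mat i j)) is js \<in> G (parT m is + parT m js)"
    if "i \<in> idxV m n" "j \<in> idxV m n" for i j "is" js
  proof (cases "theta m n r (elem_mat i j :: nat \<Rightarrow> nat \<Rightarrow> 'k) is js = 0")
    case False
    then show ?thesis
      using assms that by (simp add: theta_elem_parity end_tensor_def part_scale gl_def EndA_def)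
  qed (simp add: end_tensor_def)
  then show ?thesis
    by (auto simp: EndA_def thetaA_def end_tensor_def theta_outside intro!: part_sum)
qed

end

end

theory Submission
  imports Defs "HOL-Library.Function_Algebras"
begin

text \<open>
  For an even \<open>T\<close> in \<open>A \<otimes> End(V)\<close> let \<open>T\<^sub>l\<close> be its action on the \<open>l\<close>-th factor of \<open>V \<otimes> \<dots> \<otimes> V\<close>, the
  identity acting on the others.  Operators at different positions commute, without signs because
  they are even.  In these terms \<open>\<theta>(T)\<close> is the sum of the \<open>T\<^sub>l\<close> and \<open>\<rho>(g)\<close> is the product of the
  \<open>g\<^sub>l\<close>, that is, the first and the last elementary symmetric function
  \<open>e\<^sub>k(T) = e\<^sub>k(T\<^sub>1, \<dots>, T\<^sub>r)\<close>.  The two generated algebras agree as soon as every subalgebra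
  \<open>B\<close> that contains one of the two sets contains the other.

  From \<open>\<theta>\<close> to \<open>\<rho>\<close>: in characteristic \<open>0\<close>, Newton's identities express \<open>e\<^sub>r(g)\<close> through
  the power sums, which are \<open>\<theta>(g\<^sup>k)\<close>.  The recursion behind these identities runs through the polarizations
  \<open>D\<^sub>k(T, S)\<close>, the sum over \<open>l\<close> of \<open>T\<^sub>l\<close> times the \<open>k\<close>-th elementary symmetric function of
  the \<open>S\<^sub>i\<close> with \<open>i \<noteq> l\<close>.  They satisfy
  \<open>\<theta>(T) e\<^sub>k\<^sub>+\<^sub>1(S) = D\<^sub>k\<^sub>+\<^sub>1(T, S) + D\<^sub>k(TS, S)\<close> (\<open>theta_esym\<close>) and
  \<open>D\<^sub>k(S, S) = (k + 1) e\<^sub>k\<^sub>+\<^sub>1(S)\<close> (\<open>polar_esym_diag\<close>), so that, by induction on \<open>k\<close>, all of them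
  lie in \<open>B\<close> once the \<open>\<theta>(T)\<close> do (\<open>rho_in_subalgebra\<close>).

  From \<open>\<rho>\<close> to \<open>\<theta>\<close>: if \<open>1 + tT\<close> is invertible for infinitely many scalars \<open>t\<close>, then
  \<open>\<rho>(1 + tT)\<close>, the sum of the \<open>t\<^sup>k e\<^sub>k(T)\<close>, has all its coefficients in \<open>B\<close>, in particular \<open>e\<^sub>1(T) = \<theta>(T)\<close>.
  For a general \<open>T\<close> there may be no such \<open>t \<noteq> 0\<close>, since \<open>A\<close> is an arbitrary algebra.  But \<open>\<theta>\<close> is linear over
  the even scalars, so that it is enough to treat the elementary matrices \<open>aE\<^sub>i\<^sub>j\<close> with \<open>i \<noteq> j\<close>, whose square is \<open>0\<close>,
  and the idempotents \<open>E\<^sub>i\<^sub>i\<close>; for both, every natural number \<open>t\<close> will do (\<open>theta_elem_in_subalgebra\<close>).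

  The Koszul signs are confined to one construction: an operator on the \<open>(r + 1)\<close>-st tensor power is built
  from one on \<open>V\<close> and one on the \<open>r\<close>-th power by \<open>kron\<close>, which is multiplicative in the expected
  sense (\<open>kron_mult\<close>).  The recursions of \<open>\<rho>\<close>, \<open>\<theta>\<close>, \<open>e\<^sub>k\<close> and \<open>D\<^sub>k\<close> in \<open>r\<close> are
  expressed by \<open>kron\<close>, and the identities above follow by induction on \<open>r\<close>.
\<close>

section \<open>Coefficients of polynomial families\<close>

text \<open>
  A substitute for inverting a Vandermonde matrix: replacing \<open>f(t)\<close> by \<open>2\<^sup>d f(t) - f(2t)\<close> removes the top
  coefficient and multiplies each lower one by some \<open>2\<^sup>d - 2\<^sup>k\<close>, which is nonzero in characteristic \<open>0\<close>.
\<close>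

lemma coeffs_in_subspace:
  fixes scale :: "'k::field_char_0 \<Rightarrow> 'b::ab_group_add \<Rightarrow> 'b"
  assumes vs: "vector_space scale" and U: "module.subspace scale U"
    and val: "\<And>t::nat. (\<Sum>k\<le>d. scale (of_nat t ^ k) (c k)) \<in> U"
    and k: "k \<le> d"
  shows "c k \<in> U"
proof -
  interpret vector_space scale by (rule vs)
  show ?thesis
    using val k
  proof (induction d arbitrary: c k)
    case 0
    then show ?case by simp
  next
    case (Suc d)
    have low: "c j \<in> U" if j: "j \<le> d" for j
    proof -
      have "scale (2 ^ Suc d - 2 ^ j) (c j) \<in> U" (is "?x \<in> U")
      proof (rule Suc.IH[OF _ j, where c = "\<lambda>k. scale (2 ^ Suc d - 2 ^ k) (c k)"])
        fix t :: nat
        have "(\<Sum>k\<le>d. scale (of_nat t ^ k) (scale (2 ^ Suc d - 2 ^ k) (c k)))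
            = (\<Sum>k\<le>Suc d. scale (2 ^ Suc d) (scale (of_nat t ^ k) (c k))
                - scale (of_nat (2 * t) ^ k) (c k))"
          by (simp add: algebra_simps sum.distrib power_mult_distrib
                flip: sum_subtractf)
        also have "\<dots> = scale (2 ^ Suc d) (\<Sum>k\<le>Suc d. scale (of_nat t ^ k) (c k))
            - (\<Sum>k\<le>Suc d. scale (of_nat (2 * t) ^ k) (c k))"
          by (simp only: sum_subtractf scale_sum_right)
        also have "\<dots> \<in> U"
          using Suc.prems(1) U by (intro subspace_diff subspace_scale)
        finally show "(\<Sum>k\<le>d. scale (of_nat t ^ k) (scale (2 ^ Suc d - 2 ^ k) (c k))) \<in> U" .
      qed
      have nz: "(2 ^ Suc d - 2 ^ j :: 'k) \<noteq> 0"
      proof -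
        have "(2::nat) ^ Suc d \<noteq> 2 ^ j" using j
          by (metis Suc_n_not_le_n one_less_numeral_iff power_inject_exp semiring_norm(76))
        then have "of_nat (2 ^ Suc d) \<noteq> (of_nat (2 ^ j) :: 'k)"
          by (simp only: of_nat_eq_iff not_False_eq_True)
        then show ?thesis by simp
      qed
      have "scale (inverse (2 ^ Suc d - 2 ^ j)) ?x \<in> U"
        using U \<open>?x \<in> U\<close> by (rule subspace_scale)
      then show ?thesis unfolding scale_scale left_inverse[OF nz] scale_one .
    qed
    show ?case
    proof (cases "k = Suc d")
      case True
      have "c (Suc d) = (\<Sum>k\<le>Suc d. scale (of_nat 1 ^ k) (c k)) - (\<Sum>k\<le>d. c k)"
        by simp
      also have "\<dots> \<in> U"
        by (rule subspace_diff[OF U Suc.prems(1) subspace_sum[OF U]]) (simp add: low)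
      finally show ?thesis using True by simp
    qed (use low Suc.prems in simp)
  qed
qed

section \<open>Tensor products of operators and symmetric functions of them\<close>

text \<open>
  The matrix of \<open>v \<otimes> w \<mapsto> T v \<otimes> S w\<close> for even \<open>T\<close> and \<open>S\<close>.  The twist comes from moving the coefficients
  of \<open>S w\<close> to the left of the basis vector of \<open>V\<close>, as in \<open>tensA\<close>.
\<close>

fun kron :: "(bit \<Rightarrow> 'a::ring set) \<Rightarrow> nat \<Rightarrow> (nat \<Rightarrow> nat \<Rightarrow> 'a)
    \<Rightarrow> (nat list \<Rightarrow> nat list \<Rightarrow> 'a) \<Rightarrow> nat list \<Rightarrow> nat list \<Rightarrow> 'a"
  where
    "kron G m T S (i # is) (j # js) = T i j * twist G (parV m i) (S is js)"
  | "kron G m T S [] _ = 0"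
  | "kron G m T S _ [] = 0"

text \<open>
  The elementary symmetric function \<open>e\<^sub>k(S\<^sub>1, \<dots>, S\<^sub>r)\<close> of the actions of \<open>S\<close> on the single factors,
  expanded with respect to the first factor.
\<close>

fun esym :: "(bit \<Rightarrow> 'a::{ring, monoid_mult} set) \<Rightarrow> nat \<Rightarrow> nat \<Rightarrow> (nat \<Rightarrow> nat \<Rightarrow> 'a)
    \<Rightarrow> nat \<Rightarrow> nat \<Rightarrow> nat list \<Rightarrow> nat list \<Rightarrow> 'a"
  where
    "esym G m n S 0 r = end_one (idxT m n r)"
  | "esym G m n S (Suc k) 0 = 0"
  | "esym G m n S (Suc k) (Suc r) =
      kron G m S (esym G m n S k r) + kron G m (end_one (idxV m n)) (esym G m n S (Suc k) r)"

text \<open>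
  The sum over \<open>l\<close> of \<open>T\<^sub>l\<close> times the \<open>k\<close>-th elementary symmetric function of the \<open>S\<^sub>i\<close> with \<open>i \<noteq> l\<close>.
  In the last equation, the first summand is the term where \<open>T\<close> acts on the first factor; in the other two,
  \<open>1\<close> or \<open>S\<close> does.
\<close>

fun polar_esym :: "(bit \<Rightarrow> 'a::{ring, monoid_mult} set) \<Rightarrow> nat \<Rightarrow> nat \<Rightarrow> (nat \<Rightarrow> nat \<Rightarrow> 'a)
    \<Rightarrow> (nat \<Rightarrow> nat \<Rightarrow> 'a) \<Rightarrow> nat \<Rightarrow> nat \<Rightarrow> nat list \<Rightarrow> nat list \<Rightarrow> 'a"
  where
    "polar_esym G m n T S k 0 = 0"
  | "polar_esym G m n T S 0 (Suc r) =
      kron G m T (end_one (idxT m n r)) + kron G m (end_one (idxV m n)) (polar_esym G m n T S 0 r)"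
  | "polar_esym G m n T S (Suc k) (Suc r) =
      kron G m T (esym G m n S (Suc k) r) + kron G m (end_one (idxV m n)) (polar_esym G m n T S (Suc k) r)
      + kron G m S (polar_esym G m n T S k r)"

section \<open>Peeling off the first factor\<close>

lemma finite_idxT [simp]: "finite (idxT m n r)"
  by (induction r) (simp_all add: idxT_0 idxT_Suc idxV_def)

lemma Cons_in_idxT: "i # is \<in> idxT m n (Suc r) \<longleftrightarrow> i \<in> idxV m n \<and> is \<in> idxT m n r"
  by (auto simp: idxT_def)

lemma idxT_Suc_cases:
  assumes "is \<in> idxT m n (Suc r)"
  obtains i is' where "is = i # is'" "i \<in> idxV m n" "is' \<in> idxT m n r"
  using assms by (auto simp: idxT_Suc)

text \<open>
  The recursion of \<open>\<theta>\<close> in the number of factors: the elementary matrix acts either on the first factor, or on a later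
  one, and then passes the first basis vector, which costs the sign.
\<close>

lemma theta_elem_Cons:
  assumes "i \<in> idxV m n" "is \<in> idxT m n r" "j \<in> idxV m n" "js \<in> idxT m n r"
  shows "theta m n (Suc r) (elem_mat a b) (i # is) (j # js) =
    (elem_mat a b i j * (if is = js then 1 else 0) :: 'k::field)
    + (if i = j then ksign (parV m i * (parV m a + parV m b)) (theta m n r (elem_mat a b) is js) else 0)"
proof -
  have idx: "i # is \<in> idxT m n (Suc r)" "j # js \<in> idxT m n (Suc r)"
    using assms by (simp_all add: Cons_in_idxT)
  have len: "length is = r" "length js = r" using assms by (auto simp: idxT_def)
  let ?u = "\<lambda>s. unit_vec (js ! s) (is ! s) :: 'k"
  let ?p = "\<lambda>l. parV m (is ! l) + parV m (js ! l)"
  let ?c = "\<lambda>l. card {s. s < l \<and> parV m (js ! s) = 1}"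
  \<comment> \<open>The first letter \<open>j\<close> precedes all later positions, and counts if it is odd.\<close>
  have card: "card {s. s < Suc l \<and> parV m ((j # js) ! s) = 1} = (if parV m j = 1 then 1 else 0) + ?c l" for l
  proof -
    have "{s. s < Suc l \<and> parV m ((j # js) ! s) = 1}
        = (if parV m j = 1 then {0} else {}) \<union> Suc ` {s. s < l \<and> parV m (js ! s) = 1}"
      by (auto simp: image_iff less_Suc_eq_0_disj)
    then show ?thesis
      by (simp only:) (subst card_Un_disjoint; auto simp: card_image)
  qed
  have bit_if: "of_nat ((if parV m j = 1 then 1 else 0) + x) = parV m j + of_nat x" for x
    by (cases "parV m j") auto
  have prod0: "(\<Prod>s\<in>{..<Suc r} - {0}. unit_vec ((j # js) ! s) ((i # is) ! s)) = (if is = js then 1 else 0 :: 'k)"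
  proof -
    have "{..<Suc r} - {0} = Suc ` {..<r}" by (auto simp: image_iff less_Suc_eq_0_disj)
    then have "(\<Prod>s\<in>{..<Suc r} - {0}. unit_vec ((j # js) ! s) ((i # is) ! s)) = (\<Prod>s<r. ?u s)"
      by (simp only:) (subst prod.reindex; simp)
    also have "\<dots> = (if is = js then 1 else 0)"
    proof (cases "is = js")
      case False
      then obtain s where "s < r" "is ! s \<noteq> js ! s" using len by (auto simp: list_eq_iff_nth_eq)
      then show ?thesis using False by (auto simp: unit_vec_def)
    qed (simp add: unit_vec_def)
    finally show ?thesis .
  qed
  have prodS: "(\<Prod>s\<in>{..<Suc r} - {Suc l}. unit_vec ((j # js) ! s) ((i # is) ! s))
      = (if i = j then 1 else 0) * (\<Prod>s\<in>{..<r} - {l}. ?u s)" if "l < r" for l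
  proof -
    have "{..<Suc r} - {Suc l} = insert 0 (Suc ` ({..<r} - {l}))" by (auto simp: image_iff less_Suc_eq_0_disj)
    then show ?thesis
      by (simp only:) (subst prod.insert; simp add: prod.reindex unit_vec_def)
  qed
  \<comment> \<open>A nonzero entry forces the parities at position \<open>l\<close> to be those of \<open>a\<close> and \<open>b\<close>, so that the
    sign of \<open>j\<close> no longer depends on \<open>l\<close>.\<close>
  have sgn: "ksign (?p l * (parV m j + c)) (elem_mat a b (is ! l) (js ! l) * x)
      = ksign (parV m j * (parV m a + parV m b)) (ksign (?p l * c) (elem_mat a b (is ! l) (js ! l) * x))"
    for l c and x :: 'k
    by (cases "parV m j"; cases "parV m a"; cases "parV m b"; cases c) (auto simp: elem_mat_def)
  have ksum: "ksign p (\<Sum>l<r. f l) = (\<Sum>l<r. ksign p (f l))" for p and f :: "nat \<Rightarrow> 'k"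
    by (simp add: ksign_def sum_negf)
  have "theta m n (Suc r) (elem_mat a b) (i # is) (j # js) = elem_mat a b i j * (if is = js then 1 else 0)
      + (\<Sum>l<r. (if i = j then 1 else 0) * ksign (parV m j * (parV m a + parV m b))
        (ksign (?p l * of_nat (?c l)) (elem_mat a b (is ! l) (js ! l) * (\<Prod>s\<in>{..<r} - {l}. ?u s))))"
    unfolding theta_entry[OF idx] sum.lessThan_Suc_shift
    apply (intro arg_cong2[where f="(+)"] sum.cong refl)
    subgoal by (simp only: prod0) (simp add: ksign_def)
    subgoal for l by (simp only: lessThan_iff prodS card bit_if nth_Cons_Suc) (simp add: sgn)
    done
  then show ?thesis
    by (simp add: theta_entry[OF assms(2,4)] ksum)
qed

context comm_superalgebra
begin

section \<open>Linearity and multiplicativity of the tensor product of operators\<close>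

definition mscale :: "'k \<Rightarrow> ('i \<Rightarrow> 'j \<Rightarrow> 'a) \<Rightarrow> 'i \<Rightarrow> 'j \<Rightarrow> 'a"
  where "mscale c T = (\<lambda>i j. scale c (T i j))"

lemma mscale_apply [simp]: "mscale c T i j = scale c (T i j)"
  by (simp add: mscale_def)

lemma vector_space_mscale: "vector_space mscale"
  by standard (simp_all add: fun_eq_iff algebra_simps)

interpretation mat: vector_space "mscale :: 'k \<Rightarrow> (nat list \<Rightarrow> nat list \<Rightarrow> 'a) \<Rightarrow> _"
  by (rule vector_space_mscale)

lemma twist_scale: "twist G p (scale c x) = scale c (twist G p x)"
proof -
  have "twist G p (scale c 1 * x) = scale c 1 * twist G p x"
    using twist_hom[OF part_scale[OF one_even], of p c] by (simp only: twist_mult) simp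
  then show ?thesis by (simp add: scale_mult_left)
qed


lemma kron_add_left: "kron G m (T + T') S = kron G m T S + kron G m T' S"
proof (intro ext)
  show "kron G m (T + T') S is js = (kron G m T S + kron G m T' S) is js" for "is" js
    by (cases "is"; cases js) (simp_all add: distrib_right)
qed

lemma kron_add_right: "kron G m T (S + S') = kron G m T S + kron G m T S'"
proof (intro ext)
  show "kron G m T (S + S') is js = (kron G m T S + kron G m T S') is js" for "is" js
    by (cases "is"; cases js) (simp_all add: distrib_left twist_add)
qed

lemma kron_mscale_left: "kron G m (mscale c T) S = mscale c (kron G m T S)"
proof (intro ext)
  show "kron G m (mscale c T) S is js = mscale c (kron G m T S) is js" for "is" js
    by (cases "is"; cases js) (simp_all add: scale_mult_left)
qed

lemma kron_mscale_right: "kron G m T (mscale c S) = mscale c (kron G m T S)"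
proof (intro ext)
  show "kron G m T (mscale c S) is js = mscale c (kron G m T S) is js" for "is" js
    by (cases "is"; cases js) (simp_all add: scale_mult_right twist_scale)
qed

lemma kron_zero_right [simp]: "kron G m T 0 = 0"
proof (intro ext)
  show "kron G m T 0 is js = 0 is js" for "is" js
    by (cases "is"; cases js) simp_all
qed

lemma kron_sum_right: "kron G m T (\<Sum>x\<in>X. S x) = (\<Sum>x\<in>X. kron G m T (S x))"
  by (induction X rule: infinite_finite_induct) (simp_all only: sum.infinite sum.empty sum.insert kron_add_right kron_zero_right not_False_eq_True)

lemma kron_one: "kron G m (end_one (idxV m n)) (end_one (idxT m n r)) = end_one (idxT m n (Suc r))"
proof (intro ext)
  show "kron G m (end_one (idxV m n)) (end_one (idxT m n r)) is js = end_one (idxT m n (Suc r)) is js" for "is" js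
  proof (cases "is")
    case Nil
    then show ?thesis by (simp add: end_one_def idxT_def)
  next
    case (Cons i is')
    then show ?thesis by (cases js) (auto simp: end_one_def Cons_in_idxT)
  qed
qed

lemma end_mult_add_left: "end_mult G I P (S + S') T = end_mult G I P S T + end_mult G I P S' T"
  by (simp add: fun_eq_iff end_mult_def distrib_right sum.distrib)

lemma end_mult_add_right: "end_mult G I P S (T + T') = end_mult G I P S T + end_mult G I P S T'"
  by (simp add: fun_eq_iff end_mult_def distrib_left twist_add sum.distrib)

lemma end_mult_one_left:
  assumes "finite I" "\<And>i j. i \<notin> I \<Longrightarrow> T i j = 0"
  shows "end_mult G I P (end_one I) T = T"
proof (intro ext)
  fix i j
  have "end_mult G I P (end_one I) T i j = (\<Sum>l\<in>I. if i = l then T l j else 0)"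
    unfolding end_mult_def by (intro sum.cong) (auto simp: end_one_def)
  then show "end_mult G I P (end_one I) T i j = T i j"
    using assms by auto
qed

lemma end_mult_one_right:
  assumes "finite I" "\<And>i j. j \<notin> I \<Longrightarrow> T i j = 0"
  shows "end_mult G I P T (end_one I) = T"
proof (intro ext)
  fix i j
  have "end_mult G I P T (end_one I) i j = (\<Sum>l\<in>I. if j = l then T i l else 0)"
    unfolding end_mult_def by (intro sum.cong) (auto simp: end_one_def)
  then show "end_mult G I P T (end_one I) i j = T i j"
    using assms by auto
qed

lemma EndA_mult:
  assumes "S \<in> EndA G I P" "T \<in> EndA G I P"
  shows "end_mult G I P S T \<in> EndA G I P"
proof -
  have "S i l * twist G (P i + P l) (T l j) \<in> G (P i + P j)" if "i \<in> I" "j \<in> I" "l \<in> I" for i j l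
    using mult_part[of "S i l" "P i + P l" "twist G (P i + P l) (T l j)" "P l + P j"] assms that
    by (simp add: EndA_def twist_part bit_add_cancel)
  moreover have "end_mult G I P S T i j = 0" if "i \<notin> I \<or> j \<notin> I" for i j
    using that assms unfolding end_mult_def by (intro sum.neutral) (auto simp: EndA_def)
  ultimately show ?thesis
    by (auto simp: EndA_def end_mult_def intro!: part_sum)
qed

lemma end_one_EndA: "end_one I \<in> EndA G I P"
  by (auto simp: EndA_def end_one_def one_even)

text \<open>
  The product in \<open>A \<otimes> End\<close> twists \<open>T'\<close> by the parities of \<open>T\<close> and \<open>S\<close> together.  The
  part that belongs to \<open>S\<close> is used up by moving the entries of \<open>S\<close> past those of \<open>T'\<close>
  (\<open>twist_commute\<close>), which is where \<open>S\<close> has to be even.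
\<close>

lemma kron_mult:
  assumes S: "S \<in> EndA G (idxT m n r) (parT m)"
  shows "end_mult G (idxT m n (Suc r)) (parT m) (kron G m T S) (kron G m T' S') =
    kron G m (end_mult G (idxV m n) (parV m) T T') (end_mult G (idxT m n r) (parT m) S S')"
proof (intro ext)
  fix "is" js
  let ?I = "idxT m n (Suc r)" and ?P = "parT m"
  show "end_mult G ?I ?P (kron G m T S) (kron G m T' S') is js =
    kron G m (end_mult G (idxV m n) (parV m) T T') (end_mult G (idxT m n r) (parT m) S S') is js"
  proof (cases "is")
    case Nil
    then show ?thesis by (simp add: end_mult_def)
  next
    case row: (Cons i is')
    show ?thesis
    proof (cases js)
      case Nil
      have "kron G m T' S' l [] = 0" for l by (cases l) simp_all
      then show ?thesis by (simp add: row Nil end_mult_def)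
    next
      case col: (Cons j js')
      have "kron G m T S (i # is') (l # ls)
            * twist G (parT m (i # is') + parT m (l # ls)) (kron G m T' S' (l # ls) (j # js'))
          = T i l * twist G (parV m i + parV m l) (T' l j)
            * twist G (parV m i) (S is' ls * twist G (parT m is' + parT m ls) (S' ls js'))"
        if "ls \<in> idxT m n r" for l ls
      proof (cases "is' \<in> idxT m n r")
        case False
        then show ?thesis using S by (simp add: EndA_def)
      next
        case True
        let ?d = "parT m is' + parT m ls" and ?q = "parV m i + parV m l"
        have Sd: "twist G (parV m i) (S is' ls) \<in> G ?d"
          using S True that by (intro twist_part) (simp add: EndA_def)
        have tail: "?d + ?q + parV m l = parV m i + ?d"
          by (cases "parV m i"; cases "parV m l"; cases "parT m is'"; cases "parT m ls") simp_all
        have "T i l * twist G (parV m i) (S is' ls) * twist G (?d + ?q) (T' l j * twist G (parV m l) (S' ls js'))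
            = T i l * (twist G (parV m i) (S is' ls) * twist G ?d (twist G ?q (T' l j)))
              * twist G (?d + ?q + parV m l) (S' ls js')"
          by (simp only: twist_mult twist_twist mult.assoc)
        also have "\<dots> = T i l * (twist G ?q (T' l j) * twist G (parV m i) (S is' ls))
              * twist G (parV m i + ?d) (S' ls js')"
          unfolding twist_commute[OF Sd] tail ..
        also have "\<dots> = T i l * twist G ?q (T' l j) * twist G (parV m i) (S is' ls * twist G ?d (S' ls js'))"
          by (simp only: twist_mult twist_twist mult.assoc)
        finally show ?thesis
          by (simp only: kron.simps parT_Cons bit_add_swap[of "parV m i" "parT m is'"] add.commute[of ?q])
      qed
      then have "end_mult G ?I ?P (kron G m T S) (kron G m T' S') (i # is') (j # js')
          = (\<Sum>l\<in>idxV m n. \<Sum>ls\<in>idxT m n r. T i l * twist G (parV m i + parV m l) (T' l j)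
            * twist G (parV m i) (S is' ls * twist G (parT m is' + parT m ls) (S' ls js')))"
        unfolding end_mult_def sum_idxT_Suc by (intro sum.cong refl) blast
      then show ?thesis
        by (simp add: row col end_mult_def twist_sum sum_product)
    qed
  qed
qed

section \<open>Newton's identities for the action by derivations\<close>

lemma thetaA_0 [simp]: "thetaA scale m n 0 T = 0"
proof -
  have "theta m n 0 (X :: nat \<Rightarrow> nat \<Rightarrow> 'k) is js = 0" for X "is" js
    by (simp add: theta_def theta_hom_def)
  then show ?thesis by (simp add: fun_eq_iff thetaA_def end_tensor_def)
qed

lemma thetaA_Suc:
  assumes T: "T \<in> gl G m n"
  shows "thetaA scale m n (Suc r) T =
    kron G m T (end_one (idxT m n r)) + kron G m (end_one (idxV m n)) (thetaA scale m n r T)"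
proof (intro ext)
  fix "is" js
  show "thetaA scale m n (Suc r) T is js = (kron G m T (end_one (idxT m n r))
      + kron G m (end_one (idxV m n)) (thetaA scale m n r T)) is js"
  proof (cases "is \<in> idxT m n (Suc r) \<and> js \<in> idxT m n (Suc r)")
    case True
    then obtain i is' j js' where ij: "is = i # is'" "i \<in> idxV m n" "is' \<in> idxT m n r"
      "js = j # js'" "j \<in> idxV m n" "js' \<in> idxT m n r"
      by (meson idxT_Suc_cases)
    \<comment> \<open>As \<open>T\<close> is even, \<open>T a b\<close> has the parity of the elementary matrix: the sign that the matrix picks up
      on passing \<open>e\<^sub>i\<close> is the twist of the coefficient.\<close>
    have tw: "twist G (parV m i) (scale c (T a b)) = scale (ksign (parV m i * (parV m a + parV m b)) c) (T a b)"
      if "a \<in> idxV m n" "b \<in> idxV m n" for a b c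
      using twist_hom[OF part_scale, of "T a b" "parV m a + parV m b" "parV m i" c] T that
      by (simp add: gl_def EndA_def ksign_def)
    have ent: "scale (theta m n (Suc r) (elem_mat a b) is js) (T a b)
        = (if a = i then if b = j then if is' = js' then T a b else 0 else 0 else 0)
          + (if i = j then twist G (parV m i) (scale (theta m n r (elem_mat a b) is' js') (T a b)) else 0)"
      if "a \<in> idxV m n" "b \<in> idxV m n" for a b
    proof -
      have "scale (theta m n (Suc r) (elem_mat a b) is js) (T a b)
          = scale (elem_mat a b i j * (if is' = js' then 1 else 0)) (T a b)
            + scale (if i = j then ksign (parV m i * (parV m a + parV m b)) (theta m n r (elem_mat a b) is' js')
              else 0) (T a b)"
        using ij by (simp only: theta_elem_Cons scale_left_distrib)
      also have "scale (elem_mat a b i j * (if is' = js' then 1 else 0)) (T a b)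
          = (if a = i then if b = j then if is' = js' then T a b else 0 else 0 else 0)"
        by (simp add: elem_mat_def)
      also have "scale (if i = j then ksign (parV m i * (parV m a + parV m b)) (theta m n r (elem_mat a b) is' js')
            else 0) (T a b)
          = (if i = j then twist G (parV m i) (scale (theta m n r (elem_mat a b) is' js') (T a b)) else 0)"
        unfolding tw[OF that] by (cases "i = j") simp_all
      finally show ?thesis .
    qed
    have "thetaA scale m n (Suc r) T is js
        = (\<Sum>a\<in>idxV m n. \<Sum>b\<in>idxV m n. scale (theta m n (Suc r) (elem_mat a b) is js) (T a b))"
      by (simp add: thetaA_def end_tensor_def)
    also have "\<dots> = (\<Sum>a\<in>idxV m n. \<Sum>b\<in>idxV m n.
        (if a = i then if b = j then if is' = js' then T a b else 0 else 0 else 0)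
          + (if i = j then twist G (parV m i) (scale (theta m n r (elem_mat a b) is' js') (T a b)) else 0))"
      by (intro sum.cong refl ent)
    also have "\<dots> = (if is' = js' then T i j else 0)
        + (if i = j then twist G (parV m i) (thetaA scale m n r T is' js') else 0)"
    proof -
      have "(\<Sum>a\<in>idxV m n. \<Sum>b\<in>idxV m n. if a = i then if b = j then if is' = js' then T a b else 0 else 0 else 0)
          = (\<Sum>a\<in>idxV m n. if a = i then \<Sum>b\<in>idxV m n. if b = j then if is' = js' then T a b else 0 else 0 else 0)"
        by (intro sum.cong refl) simp
      also have "\<dots> = (if is' = js' then T i j else 0)"
        using ij(2,5) by simp
      finally show ?thesis
        by (simp add: sum.distrib thetaA_def end_tensor_def twist_sum)
    qed
    finally have "thetaA scale m n (Suc r) T is js = (if is' = js' then T i j else 0)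
        + (if i = j then twist G (parV m i) (thetaA scale m n r T is' js') else 0)" .
    then show ?thesis
      using ij by (simp add: end_one_def)
  next
    case False
    have "thetaA scale m n (Suc r) T is js = 0"
      using False by (auto simp: thetaA_def end_tensor_def theta_outside)
    moreover have "kron G m T (end_one (idxT m n r)) is js = 0"
      using False T by (cases "is"; cases js) (auto simp: Cons_in_idxT end_one_def gl_def EndA_def)
    moreover have "kron G m (end_one (idxV m n)) (thetaA scale m n r T) is js = 0"
      using False thetaA_EndA[OF T, of r]
      by (cases "is"; cases js) (auto simp: Cons_in_idxT end_one_def EndA_def)
    ultimately show ?thesis by simp
  qed
qed


lemma esym_outside:
  assumes "\<And>i j. i \<notin> idxV m n \<Longrightarrow> S i j = 0" "is \<notin> idxT m n r"
  shows "esym G m n S k r is js = 0"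
  using assms(2)
proof (induction r arbitrary: k "is" js)
  case 0
  then show ?case by (cases k) (simp_all add: end_one_def)
next
  case (Suc r)
  show ?case
  proof (cases k)
    case 0
    then show ?thesis using Suc.prems by (simp add: end_one_def)
  next
    case (Suc k')
    then show ?thesis
      using Suc.prems assms(1)
      by (cases "is"; cases js) (auto simp: Cons_in_idxT end_one_def Suc.IH)
  qed
qed

lemma esym_eq_0: "r < k \<Longrightarrow> esym G m n S k r = 0"
proof (induction r arbitrary: k)
  case 0
  then show ?case by (cases k) simp_all
next
  case (Suc r)
  then obtain k' where "k = Suc k'" "r < k'" by (cases k) auto
  with Suc.IH[of k'] Suc.IH[of k] show ?case by (simp del: plus_fun_apply zero_fun_apply)
qed

lemma esym_1:
  assumes "T \<in> gl G m n"
  shows "esym G m n T 1 r = thetaA scale m n r T"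
proof (induction r)
  case (Suc r)
  then show ?case by (simp add: thetaA_Suc[OF assms])
qed simp

lemma polar_esym_0:
  assumes "T \<in> gl G m n"
  shows "polar_esym G m n T S 0 r = thetaA scale m n r T"
  by (induction r) (simp_all add: thetaA_Suc[OF assms])

text \<open>Each product of \<open>k + 1\<close> of the \<open>S\<^sub>l\<close> arises \<open>k + 1\<close> times, once for each choice of the marked factor.\<close>

lemma polar_esym_diag: "polar_esym G m n S S k r = mscale (of_nat (Suc k)) (esym G m n S (Suc k) r)"
proof (induction r arbitrary: k)
  case 0
  show ?case by simp
next
  case (Suc r)
  show ?case
  proof (cases k)
    case 0
    then show ?thesis by (simp add: Suc.IH)
  next
    case (Suc k')
    have "mscale (of_nat (Suc (Suc k'))) X = X + mscale (of_nat (Suc k')) X" for X :: "nat list \<Rightarrow> nat list \<Rightarrow> 'a"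
      by (simp only: of_nat_Suc[of "Suc k'"] mat.scale_left_distrib mat.scale_one)
    note s = this
    show ?thesis
      unfolding Suc polar_esym.simps esym.simps(3)[of _ _ _ _ "Suc k'"] Suc.IH kron_mscale_right
      by (simp only: mat.scale_right_distrib s[of "kron G m S _"] ac_simps)
  qed
qed

text \<open>
  In \<open>T\<^sub>l\<close> times a product of \<open>k + 1\<close> of the \<open>S\<^sub>i\<close>, either \<open>l\<close> is not among the positions \<open>i\<close>, or
  \<open>T\<^sub>l S\<^sub>l = (TS)\<^sub>l\<close> is multiplied by the remaining \<open>k\<close> factors.
\<close>

lemma theta_esym:
  assumes T: "T \<in> gl G m n" and S: "S \<in> gl G m n"
  shows "end_mult G (idxT m n r) (parT m) (thetaA scale m n r T) (esym G m n S (Suc k) r) =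
    polar_esym G m n T S (Suc k) r + polar_esym G m n (end_mult G (idxV m n) (parV m) T S) S k r"
proof (induction r arbitrary: k)
  case 0
  show ?case by (simp add: fun_eq_iff end_mult_def)
next
  case (Suc r)
  let ?V1 = "end_one (idxV m n)" and ?T1 = "end_one (idxT m n r)"
  let ?m = "end_mult G (idxT m n r) (parT m)" and ?TS = "end_mult G (idxV m n) (parV m) T S"
  note th = thetaA_EndA[OF T, of r]
  have S0: "\<And>i j. i \<notin> idxV m n \<Longrightarrow> S i j = 0"
    and T0: "\<And>i j. j \<notin> idxV m n \<Longrightarrow> T i j = 0"
    and th0: "\<And>is js. js \<notin> idxT m n r \<Longrightarrow> thetaA scale m n r T is js = 0"
    using S T th by (auto simp: gl_def EndA_def)
  have one: "?m ?T1 (esym G m n S k' r) = esym G m n S k' r" for k'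
    by (rule end_mult_one_left) (auto intro: esym_outside[OF S0])
  have V: "end_mult G (idxV m n) (parV m) ?V1 S = S" "end_mult G (idxV m n) (parV m) T ?V1 = T"
    "end_mult G (idxV m n) (parV m) ?V1 ?V1 = ?V1"
    using end_mult_one_left[OF finite_idxV S0] end_mult_one_right[OF finite_idxV T0]
      end_mult_one_left[OF finite_idxV, of m n ?V1 "parV m"] by (simp_all add: end_one_def)
  have t1: "?m (thetaA scale m n r T) ?T1 = thetaA scale m n r T"
    using th0 by (intro end_mult_one_right) auto
  have "end_mult G (idxT m n (Suc r)) (parT m) (thetaA scale m n (Suc r) T) (esym G m n S (Suc k) (Suc r))
      = kron G m ?TS (esym G m n S k r) + kron G m T (esym G m n S (Suc k) r)
        + kron G m S (?m (thetaA scale m n r T) (esym G m n S k r))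
        + kron G m ?V1 (?m (thetaA scale m n r T) (esym G m n S (Suc k) r))"
    unfolding thetaA_Suc[OF T] esym.simps end_mult_add_left end_mult_add_right
      kron_mult[OF th] kron_mult[OF end_one_EndA] one V
    by (simp only: ac_simps)
  also have "\<dots> = polar_esym G m n T S (Suc k) (Suc r) + polar_esym G m n ?TS S k (Suc r)"
  proof (cases k)
    case 0
    then show ?thesis
      by (simp only: Suc.IH polar_esym.simps esym.simps t1 polar_esym_0[OF T] kron_add_right ac_simps)
  next
    case k: (Suc k')
    then show ?thesis
      by (simp only: Suc.IH polar_esym.simps kron_add_right ac_simps)
  qed
  finally show ?case .
qed

section \<open>Subalgebras over the even scalars\<close>

text \<open>The scalar \<open>c\<close> acts as the even element \<open>c 1\<close> of \<open>A\<close>.\<close>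

lemma subalgebra_mscale:
  assumes "is_subalgebra G I P B" "T \<in> B"
  shows "mscale c T \<in> B"
proof -
  have "(\<lambda>i j. scale c 1 * T i j) \<in> B"
    using assms part_scale[OF one_even, of c] by (simp add: is_subalgebra_def)
  then show ?thesis by (simp add: scale_mult_left mscale_def)
qed

lemma subalgebra_subspace:
  fixes B :: "('i \<Rightarrow> 'i \<Rightarrow> 'a) set"
  assumes "is_subalgebra G I P B"
  shows "module.subspace mscale B"
proof -
  interpret sq: vector_space "mscale :: _ \<Rightarrow> ('i \<Rightarrow> 'i \<Rightarrow> 'a) \<Rightarrow> _" by (rule vector_space_mscale)
  have one: "end_one I \<in> B" using assms by (simp add: is_subalgebra_def)
  have "S + T \<in> B" if "S \<in> B" "T \<in> B" for S T
    using assms that by (simp add: is_subalgebra_def plus_fun_def)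
  then show ?thesis
    using subalgebra_mscale[OF assms one, of 0] subalgebra_mscale[OF assms]
    by (simp add: sq.subspace_def)
qed

section \<open>The group action as a symmetric function\<close>

definition mat_of :: "nat \<Rightarrow> nat \<Rightarrow> ((nat \<Rightarrow> 'a) \<Rightarrow> nat \<Rightarrow> 'a) \<Rightarrow> nat \<Rightarrow> nat \<Rightarrow> 'a"
  where "mat_of m n g = (\<lambda>i j. if i \<in> idxV m n \<and> j \<in> idxV m n then g (unit_vec j) i else 0)"

lemma mat_of_gl: "g \<in> GL G m n \<Longrightarrow> mat_of m n g \<in> gl G m n"
  by (simp add: mat_of_def gl_def EndA_def GL_unit_part)

lemma rho_0: "rho G m n 0 g = end_one (idxT m n 0)"
  by (auto simp: fun_eq_iff rho_def end_one_def idxT_0)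

lemma rho_Suc: "rho G m n (Suc r) g = kron G m (mat_of m n g) (rho G m n r g)"
proof (intro ext)
  show "rho G m n (Suc r) g is js = kron G m (mat_of m n g) (rho G m n r g) is js" for "is" js
    by (cases "is"; cases js) (auto simp: rho_def mat_of_def Cons_in_idxT, auto simp: idxT_def)
qed

lemma rho_eq_esym: "rho G m n r g = esym G m n (mat_of m n g) r r"
  by (induction r) (simp_all add: rho_0 rho_Suc esym_eq_0)

text \<open>This is the identity \<open>(1 + cT\<^sub>1) \<dots> (1 + cT\<^sub>r) = \<Sum> c\<^sup>k e\<^sub>k(T)\<close>.\<close>

lemma rho_expand:
  assumes "mat_of m n g = end_one (idxV m n) + mscale c T"
  shows "rho G m n r g = (\<Sum>k\<le>r. mscale (c ^ k) (esym G m n T k r))"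
proof (induction r)
  case 0
  show ?case by (simp add: rho_0)
next
  case (Suc r)
  let ?one = "kron G m (end_one (idxV m n))"
  have "rho G m n (Suc r) g = (\<Sum>k\<le>r. mscale (c ^ k) (?one (esym G m n T k r)))
      + (\<Sum>k\<le>r. mscale (c ^ Suc k) (kron G m T (esym G m n T k r)))"
    by (simp only: rho_Suc Suc.IH assms kron_add_left kron_sum_right kron_mscale_left kron_mscale_right
      mat.scale_scale power_Suc2 mat.scale_right_distrib sum.distrib)
  also have "(\<Sum>k\<le>r. mscale (c ^ k) (?one (esym G m n T k r)))
      = (\<Sum>k\<le>Suc r. mscale (c ^ k) (?one (esym G m n T k r)))"
    by (simp only: sum.atMost_Suc esym_eq_0[of r "Suc r"] lessI kron_zero_right mat.scale_zero_right add_0_right)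
  also have "\<dots> + (\<Sum>k\<le>r. mscale (c ^ Suc k) (kron G m T (esym G m n T k r)))
      = (\<Sum>k\<le>Suc r. mscale (c ^ k) (esym G m n T k (Suc r)))"
    unfolding sum.atMost_Suc_shift[of _ r] esym.simps kron_one mat.scale_right_distrib sum.distrib
    by (simp only: ac_simps)
  finally show ?case .
qed

text \<open>
  The map \<open>1 + b E\<^sub>i\<^sub>j\<close>, with the coefficient on the right because \<open>A\<close> acts on the left.  For \<open>i = j\<close> it
  multiplies one coordinate by \<open>1 + b\<close>.
\<close>

definition shear :: "nat \<Rightarrow> nat \<Rightarrow> 'a \<Rightarrow> (nat \<Rightarrow> 'a) \<Rightarrow> nat \<Rightarrow> 'a"
  where "shear i j b v = (\<lambda>s. if s = i then v s + v j * b else v s)"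

text \<open>
  The equations for \<open>b'\<close> say that \<open>1 + b' E\<^sub>i\<^sub>j\<close> is a two-sided inverse of \<open>1 + b E\<^sub>i\<^sub>j\<close>; the products only
  occur for \<open>i = j\<close>, since \<open>E\<^sub>i\<^sub>j E\<^sub>i\<^sub>j = 0\<close> otherwise.
\<close>

lemma shear_GL:
  assumes ij: "i \<in> idxV m n" "j \<in> idxV m n" and b: "b \<in> G (parV m i + parV m j)"
    and inv: "b + b' + (if i = j then b * b' else 0) = 0" "b + b' + (if i = j then b' * b else 0) = 0"
  shows "shear i j b \<in> GL G m n"
proof -
  have ext: "shear i j c v \<in> ext_space (idxV m n)" if "v \<in> ext_space (idxV m n)" for c v
    using that ij by (auto simp: ext_space_def shear_def)
  have cancel: "shear i j d (shear i j c v) = v" if "c + d + (if i = j then c * d else 0) = 0" for c d v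
  proof -
    have "v i + v j * c + (if i = j then v j + v j * c else v j) * d
        = v i + v j * (c + d + (if i = j then c * d else 0))"
      by (simp add: algebra_simps)
    then show ?thesis unfolding that by (auto simp: shear_def fun_eq_iff)
  qed
  have "bij_betw (shear i j b) (ext_space (idxV m n)) (ext_space (idxV m n))"
    using ext cancel inv by (intro bij_betw_byWitness[where f' = "shear i j b'"]) (auto simp: ac_simps)
  moreover have "shear i j b v \<in> ext_part G (idxV m n) (parV m) q"
    if v: "v \<in> ext_part G (idxV m n) (parV m) q" for q v
  proof -
    have "v j * b \<in> G (q + parV m j + (parV m i + parV m j))"
      using v ij b by (intro mult_part) (auto simp: ext_part_def)
    also have "q + parV m j + (parV m i + parV m j) = q + parV m i"
      by (simp add: ac_simps)
    finally show ?thesis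
      using v ext[of v b] ij by (auto simp: ext_part_def shear_def intro: part_add)
  qed
  ultimately show ?thesis
    by (auto simp: GL_def shear_def fun_eq_iff algebra_simps)
qed

end

section \<open>The two generated subalgebras\<close>

lemma sum_matrix_apply: "(\<Sum>x\<in>X. F x) i j = (\<Sum>x\<in>X. F x i j)"
  by (induction X rule: infinite_finite_induct) simp_all

locale comm_superalgebra_char_0 = comm_superalgebra scale G
  for scale :: "'k::field_char_0 \<Rightarrow> 'a::{ring, monoid_mult} \<Rightarrow> 'a" and G
begin

interpretation mat: vector_space "mscale :: 'k \<Rightarrow> (nat list \<Rightarrow> nat list \<Rightarrow> 'a) \<Rightarrow> _"
  by (rule vector_space_mscale)

text \<open>
  Newton's recursion: \<open>theta_esym\<close> gives \<open>D\<^sub>k\<^sub>+\<^sub>1(T, S)\<close> from \<open>\<theta>(T) e\<^sub>k\<^sub>+\<^sub>1(S)\<close> and \<open>D\<^sub>k(TS, S)\<close>, while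
  \<open>e\<^sub>k\<^sub>+\<^sub>1(S)\<close> is \<open>D\<^sub>k(S, S)\<close> divided by \<open>k + 1\<close>.  The induction has to cover all \<open>T\<close> at once
  because the step replaces \<open>T\<close> by \<open>TS\<close>.
\<close>

lemma rho_in_subalgebra:
  assumes B: "is_subalgebra G (idxT m n r) (parT m) B" and th: "thetaA scale m n r ` gl G m n \<subseteq> B"
    and g: "g \<in> GL G m n"
  shows "rho G m n r g \<in> B"
proof -
  note sub = subalgebra_subspace[OF B]
  define S where "S = mat_of m n g"
  have S: "S \<in> gl G m n" using g by (simp add: S_def mat_of_gl)
  have "esym G m n S k r \<in> B \<and> (\<forall>T\<in>gl G m n. polar_esym G m n T S k r \<in> B)" for k
  proof (induction k)
    case 0
    then show ?case using B th by (auto simp: is_subalgebra_def polar_esym_0)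
  next
    case (Suc k)
    have "mscale (inverse (of_nat (Suc k))) (polar_esym G m n S S k r) \<in> B"
      using Suc S sub by (intro mat.subspace_scale) auto
    then have e: "esym G m n S (Suc k) r \<in> B"
      unfolding polar_esym_diag by (simp del: of_nat_Suc)
    have "polar_esym G m n T S (Suc k) r \<in> B" if T: "T \<in> gl G m n" for T
    proof -
      have "end_mult G (idxT m n r) (parT m) (thetaA scale m n r T) (esym G m n S (Suc k) r) \<in> B"
        using B e th T by (auto simp: is_subalgebra_def)
      moreover have "polar_esym G m n (end_mult G (idxV m n) (parV m) T S) S k r \<in> B"
        using Suc EndA_mult[of T "idxV m n" "parV m" S] S T by (simp add: gl_def)
      ultimately have "end_mult G (idxT m n r) (parT m) (thetaA scale m n r T) (esym G m n S (Suc k) r)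
          - polar_esym G m n (end_mult G (idxV m n) (parV m) T S) S k r \<in> B"
        by (rule mat.subspace_diff[OF sub])
      then show ?thesis unfolding theta_esym[OF T S] by (simp only: add_diff_cancel_right')
    qed
    with e show ?case by blast
  qed
  then show ?thesis by (simp add: rho_eq_esym S_def)
qed

text \<open>
  The condition on \<open>a\<close> makes \<open>T = aE\<^sub>i\<^sub>j\<close> idempotent or of square \<open>0\<close>, so that \<open>1 + tT\<close> is invertible for
  every natural number \<open>t\<close>, and \<open>\<theta>(T)\<close> is the coefficient of \<open>t\<close> in \<open>\<rho>(1 + tT)\<close>.
\<close>

lemma theta_elem_in_subalgebra:
  assumes B: "is_subalgebra G (idxT m n r) (parT m) B" and rho: "rho G m n r ` GL G m n \<subseteq> B"
    and ij: "i \<in> idxV m n" "j \<in> idxV m n" and a: "a \<in> G (parV m i + parV m j)" "i = j \<Longrightarrow> a = 1"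
  shows "thetaA scale m n r (\<lambda>s t. if s = i \<and> t = j then a else 0) \<in> B"
proof -
  define T where "T = (\<lambda>s t. if s = i \<and> t = j then a else 0)"
  have T: "T \<in> gl G m n" using ij a by (auto simp: T_def gl_def EndA_def)
  have val: "(\<Sum>k\<le>r. mscale (of_nat t ^ k) (esym G m n T k r)) \<in> B" for t :: nat
  proof -
    let ?b = "scale (of_nat t) a"
    \<comment> \<open>\<open>(1 + tE)\<^sup>-\<^sup>1 = 1 - t/(1 + t) E\<close> for an idempotent \<open>E\<close>, and \<open>1 - tE\<close> if \<open>E\<close> has square \<open>0\<close>.\<close>
    let ?b' = "if i = j then scale (- of_nat t / (1 + of_nat t)) a else scale (- of_nat t) a"
    have nz: "1 + of_nat t \<noteq> (0::'k)"
      using of_nat_neq_0[of t, where 'a = 'k] by simp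
    have dil: "of_nat t + - of_nat t / (1 + of_nat t) + of_nat t * (- of_nat t / (1 + of_nat t)) = (0::'k)"
      using nz by (simp add: field_simps)
    have inv: "?b + ?b' + (if i = j then ?b * ?b' else 0) = 0" "?b + ?b' + (if i = j then ?b' * ?b else 0) = 0"
    proof -
      have "scale (of_nat t) 1 + scale (- of_nat t / (1 + of_nat t)) 1
        + scale (of_nat t * (- of_nat t / (1 + of_nat t))) 1 = 0"
        unfolding scale_left_distrib[symmetric] dil by simp
      then show "?b + ?b' + (if i = j then ?b * ?b' else 0) = 0" "?b + ?b' + (if i = j then ?b' * ?b else 0) = 0"
        using a(2) by (auto simp: scale_mult_left mult.commute)
    qed
    have g: "shear i j ?b \<in> GL G m n"
      using part_scale[OF a(1)] inv by (rule shear_GL[OF ij])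
    have "mat_of m n (shear i j ?b) = end_one (idxV m n) + mscale (of_nat t) T"
      using ij by (auto simp: fun_eq_iff mat_of_def shear_def end_one_def unit_vec_def T_def)
    then have "rho G m n r (shear i j ?b) = (\<Sum>k\<le>r. mscale (of_nat t ^ k) (esym G m n T k r))"
      by (rule rho_expand)
    then show ?thesis using rho g by auto
  qed
  have "esym G m n T 1 r \<in> B"
  proof (cases "r = 0")
    \<comment> \<open>For \<open>r = 0\<close> the expansion has no coefficient of index \<open>1\<close>.\<close>
    case True
    then show ?thesis using module.subspace_0[OF _ subalgebra_subspace[OF B]] vector_space_mscale
      by (simp add: module_iff_vector_space)
  next
    case False
    show ?thesis
      by (rule coeffs_in_subspace[OF vector_space_mscale subalgebra_subspace[OF B], where d = r])
        (use val False in auto)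
  qed
  then show ?thesis using esym_1[OF T] by (simp add: T_def)
qed

text \<open>
  An even diagonal entry \<open>a\<close> can be taken out of \<open>\<theta>(aE\<^sub>i\<^sub>i) = a \<theta>(E\<^sub>i\<^sub>i)\<close>, because \<open>B\<close> is closed under
  multiplication by even elements of \<open>A\<close>.
\<close>

lemma theta_in_subalgebra:
  assumes B: "is_subalgebra G (idxT m n r) (parT m) B" and rho: "rho G m n r ` GL G m n \<subseteq> B"
    and T: "T \<in> gl G m n"
  shows "thetaA scale m n r T \<in> B"
proof -
  have sum: "thetaA scale m n r T
      = (\<Sum>i\<in>idxV m n. \<Sum>j\<in>idxV m n. end_tensor scale (T i j) (theta m n r (elem_mat i j)))"
    by (simp add: fun_eq_iff thetaA_def sum_matrix_apply)
  have single: "thetaA scale m n r (\<lambda>s t. if s = i \<and> t = j then a else 0)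
      = end_tensor scale a (theta m n r (elem_mat i j))" if "i \<in> idxV m n" "j \<in> idxV m n" for i j a
  proof -
    have "(elem_mat i j :: nat \<Rightarrow> nat \<Rightarrow> 'k) \<in> mat_space (idxV m n)" using that by (auto simp: mat_space_def elem_mat_def)
    moreover have "(\<lambda>s t. if s = i \<and> t = j then a else 0) = end_tensor scale a (elem_mat i j)"
      by (auto simp: fun_eq_iff end_tensor_def elem_mat_def)
    ultimately show ?thesis by (simp only: thetaA_tensor)
  qed
  have "end_tensor scale (T i j) (theta m n r (elem_mat i j)) \<in> B"
    if ij: "i \<in> idxV m n" "j \<in> idxV m n" for i j
  proof (cases "i = j")
    case False
    then show ?thesis
      using theta_elem_in_subalgebra[OF B rho ij, of "T i j"] T ij
      by (simp add: single gl_def EndA_def)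
  next
    case True
    have "end_tensor scale 1 (theta m n r (elem_mat i j)) \<in> B"
      using theta_elem_in_subalgebra[OF B rho ij, of 1] True by (simp add: single ij one_even)
    moreover have "T i j \<in> G 0"
    proof -
      have "T i j \<in> G (parV m i + parV m j)" using T ij by (simp add: gl_def EndA_def)
      then show ?thesis using True by simp
    qed
    ultimately have "(\<lambda>s t. T i j * end_tensor scale 1 (theta m n r (elem_mat i j)) s t) \<in> B"
      using B by (simp add: is_subalgebra_def)
    then show ?thesis by (simp add: end_tensor_def scale_mult_right)
  qed
  then show ?thesis
    unfolding sum using subalgebra_subspace[OF B] by (intro mat.subspace_sum) auto
qed

end

theorem theorem4p6:
  fixes scale :: "'k::{alg_closed_field, field_char_0} \<Rightarrow> 'a::{ring, monoid_mult} \<Rightarrow> 'a"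
    and G :: "bit \<Rightarrow> 'a set"
    and m n r :: nat
  assumes "comm_superalgebra scale G"
  shows "gen_subalgebra G (idxT m n r) (parT m) (rho G m n r ` GL G m n) =
    gen_subalgebra G (idxT m n r) (parT m) (thetaA scale m n r ` gl G m n)"
proof -
  interpret comm_superalgebra_char_0 scale G
    using assms by (simp add: comm_superalgebra_char_0_def)
  have same: "rho G m n r ` GL G m n \<subseteq> B \<longleftrightarrow> thetaA scale m n r ` gl G m n \<subseteq> B"
    if "is_subalgebra G (idxT m n r) (parT m) B" for B
    using rho_in_subalgebra[OF that] theta_in_subalgebra[OF that] by blast
  show ?thesis
    unfolding gen_subalgebra_def hull_def using same by (intro arg_cong[where f = Inter] Collect_cong) blast
qed

end
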